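(* There exists an absolute constant $n_0$ such that for every integer $n\ge n_0$ and every convex body $K$ in $\mathbb{R}^n$, $$f_n(K)\ \le\ \Bigl\lceil (n\log n+n\log\log n+5n)\,\frac{\mathrm{Vol}_n(K-K)}{\mathrm{Vol}_n(K)}\Bigr\rceil .$$
   Context: A convex body in $\mathbb{R}^n$ is a compact convex set with non-empty interior. $\mathrm{Vol}_n$ is the Lebesgue measure in $\mathbb{R}^n$, and $K-K=\{x-y: x,y\in K\}$. $\log$ is the natural logarithm. For a convex body $K$ in $\mathbb{R}^n$, $f_n(K)$ denotes the least positive number such that for any sequence $(\lambda_i)$ with $\lambda_i\in[0,1)$ and $\sum_i\lambda_i^n>f_n(K)$ there are points $x_i\in\mathbb{R}^n$ such that the collection of homothets $\{\lambda_i K+x_i\}$ covers $K$, i.e. $K\subset\bigcup_i(\lambda_i K+x_i)$. *)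

theory Defs
  imports "HOL-Analysis.Analysis"
begin

text \<open>
  The dimension \<open>n\<close> is bound inside the theorem (after \<open>\<exists>n\<^sub>0\<close>), so it cannot be a type. Points of
  \<open>n\<close>-space are the functions on \<open>{..<n}\<close> extended by \<open>undefined\<close>. These are both the points of
  the product topology and the space of the product measure used below, so vector operations
  are pointwise and then restricted to \<open>{..<n}\<close>.
\<close>

definition rspace :: "nat \<Rightarrow> (nat \<Rightarrow> real) set" where
  "rspace n = ({..<n} \<rightarrow>\<^sub>E UNIV)"

definition rspace_top :: "nat \<Rightarrow> (nat \<Rightarrow> real) topology" where
  "rspace_top n = product_topology (\<lambda>_. euclideanreal) {..<n}"

text \<open>
  This is Lebesgue measure on Borel sets, without completion. It is only applied to compact sets.
\<close>

definition Vol :: "nat \<Rightarrow> (nat \<Rightarrow> real) set \<Rightarrow> real" where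
  "Vol n A = measure (\<Pi>\<^sub>M i\<in>{..<n}. lborel) A"

definition convex_body :: "nat \<Rightarrow> (nat \<Rightarrow> real) set \<Rightarrow> bool" where
  "convex_body n K \<longleftrightarrow>
     compactin (rspace_top n) K \<and>
     (\<forall>x\<in>K. \<forall>y\<in>K. \<forall>t\<in>{0..1}. (\<lambda>i\<in>{..<n}. (1 - t) * x i + t * y i) \<in> K) \<and>
     rspace_top n interior_of K \<noteq> {}"

definition difference_body :: "nat \<Rightarrow> (nat \<Rightarrow> real) set \<Rightarrow> (nat \<Rightarrow> real) set" where
  "difference_body n K = {(\<lambda>i\<in>{..<n}. x i - y i) | x y. x \<in> K \<and> y \<in> K}"

definition homothet :: "nat \<Rightarrow> real \<Rightarrow> (nat \<Rightarrow> real) set \<Rightarrow> (nat \<Rightarrow> real) \<Rightarrow> (nat \<Rightarrow> real) set" where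
  "homothet n c K x = (\<lambda>k. \<lambda>i\<in>{..<n}. c * k i + x i) ` K"

definition covered_by_homothets :: "nat \<Rightarrow> (nat \<Rightarrow> real) set \<Rightarrow> (nat \<Rightarrow> real) \<Rightarrow> bool" where
  "covered_by_homothets n K lam \<longleftrightarrow>
     (\<exists>x :: nat \<Rightarrow> nat \<Rightarrow> real. (\<forall>j. x j \<in> rspace n) \<and> K \<subseteq> (\<Union>j. homothet n (lam j) K (x j)))"

text \<open>
  The sum is taken in \<^typ>\<open>ennreal\<close>, so a divergent series counts as exceeding every finite threshold.
  The threshold is also in \<^typ>\<open>ennreal\<close>: if no finite number has the property, the least one is
  \<open>\<infinity>\<close> (for which the property is vacuous). For convex bodies with \<open>n \<ge> 1\<close> the least element exists.
  Finite sequences are padded with zeros.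
\<close>

definition f_cover :: "nat \<Rightarrow> (nat \<Rightarrow> real) set \<Rightarrow> ennreal" where
  "f_cover n K =
     (LEAST c :: ennreal. 0 < c \<and>
        (\<forall>lam :: nat \<Rightarrow> real. (\<forall>j. 0 \<le> lam j \<and> lam j < 1) \<longrightarrow>
           c < (\<Sum>j. ennreal (lam j ^ n)) \<longrightarrow> covered_by_homothets n K lam))"

end

theory Submission
  imports Defs "HOL-Real_Asymp.Real_Asymp"
begin

text \<open>
  Translate \<open>K\<close> so that \<open>0 \<in> K\<close>, put \<open>\<delta> = 1/(n ln n)\<close> and \<open>R = |K - K|/|K|\<close>, and place finitely many
  homothets in decreasing order of their ratios \<open>\<mu>\<close>, watching the volume of the part \<open>W\<close> of \<open>K - \<delta>K\<close>
  not covered by the shrunken copies \<open>(1 - \<delta>)\<mu>K + y\<close>. By Fubini some translate of a set \<open>L\<close> meets \<open>W\<close>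
  in volume at least \<open>|W| |L| / |W - L|\<close>.

  First, use this with \<open>W - L \<subseteq> K - K\<close>: each copy multiplies \<open>|W|\<close> by at most
  \<open>1 - (1 - \<delta>)\<^sup>n \<mu>\<^sup>n / R\<close>. Since initially \<open>|W| \<le> 4\<^sup>n |K|\<close>, when the sum of the \<open>\<mu>\<^sup>n\<close> used has
  come within \<open>2\<close> of the threshold, \<open>|W|\<close> is at most \<open>(1 - \<delta>)\<^sup>n \<delta>\<^sup>n |K|\<close>.

  From then on, if a point \<open>p\<close> of \<open>K\<close> is missed by all full copies so far, then
  \<open>Q = p - \<delta>\<mu>K\<close> lies in \<open>W\<close>, because all earlier ratios are at least \<open>\<mu>\<close>. Applied to \<open>Q\<close>, where now
  \<open>Q - L = p - \<mu>K\<close>, the averaging argument removes volume \<open>(1 - \<delta>)\<^sup>n \<delta>\<^sup>n \<mu>\<^sup>n |K|\<close>. The remaining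
  \<open>\<mu>\<^sup>n\<close> have sum greater than \<open>1\<close>, so this cannot go on to the end.
\<close>

section \<open>Lebesgue measure and homothets\<close>

abbreviation lebn :: "nat \<Rightarrow> (nat \<Rightarrow> real) measure" where
  "lebn n \<equiv> \<Pi>\<^sub>M i\<in>{..<n}. lborel"

lemma space_lebn: "space (lebn n) = rspace n"
  by (simp add: space_PiM rspace_def)

lemma restrict_in_rspace [simp]: "(\<lambda>i\<in>{..<n}. f i) \<in> rspace n"
  by (simp add: rspace_def)

lemma rspace_eqI:
  assumes "x \<in> rspace n" "y \<in> rspace n" "\<And>i. i < n \<Longrightarrow> x i = y i"
  shows "x = y"
  using assms unfolding rspace_def by (metis PiE_ext lessThan_iff)

interpretation lebn: product_sigma_finite "\<lambda>_::nat. lborel :: real measure"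
  by standard

lemma sigma_finite_lebn: "sigma_finite_measure (lebn n)"
  by (rule lebn.sigma_finite) simp

lemma measurable_affine:
  "(\<lambda>k. \<lambda>i\<in>{..<n}. c * k i + t i) \<in> measurable (lebn n) (lebn n)"
  by measurable

lemma emeasure_lborel_vimage_affine:
  fixes c t :: real
  assumes "c \<noteq> 0" and [measurable]: "A \<in> sets borel"
  shows "emeasure lborel A = ennreal \<bar>c\<bar> * emeasure lborel ((\<lambda>x. c * x + t) -` A)"
proof -
  have m [measurable]: "(\<lambda>x::real. c * x + t) \<in> borel_measurable borel" by simp
  have s: "(\<lambda>x. c * x + t) -` A \<in> sets borel"
    using measurable_sets[OF m assms(2)] by simp
  have "emeasure lborel A = (\<integral>\<^sup>+x. indicator A x \<partial>lborel)" by simp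
  also have "\<dots> = \<bar>c\<bar> * (\<integral>\<^sup>+x. indicator A (t + c * x) \<partial>lborel)"
    by (rule nn_integral_real_affine) (use assms in auto)
  also have "(\<integral>\<^sup>+x. indicator A (t + c * x) \<partial>lborel)
      = (\<integral>\<^sup>+x. indicator ((\<lambda>x. c * x + t) -` A) x \<partial>lborel)"
    by (intro nn_integral_cong) (auto simp: indicator_def add.commute)
  also have "\<dots> = emeasure lborel ((\<lambda>x. c * x + t) -` A)" using s by simp
  finally show ?thesis .
qed

text \<open>Boxes determine the product measure. On a box, the push-forward of \<open>lebn n\<close>
  under the affine map, rescaled by \<open>\<bar>c\<bar> ^ n\<close>, factors into one-dimensional
  changes of variable.\<close>

lemma emeasure_vimage_affine:
  fixes c :: real
  assumes c: "c \<noteq> 0" and A: "A \<in> sets (lebn n)"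
  shows "emeasure (lebn n) A = ennreal (\<bar>c\<bar> ^ n) *
    emeasure (lebn n) ((\<lambda>k. \<lambda>i\<in>{..<n}. c * k i + t i) -` A \<inter> rspace n)"
proof -
  define T where "T = (\<lambda>k. \<lambda>i\<in>{..<n}. c * k i + t i)"
  have T [measurable]: "T \<in> measurable (lebn n) (lebn n)"
    unfolding T_def by (rule measurable_affine)
  let ?P = "scale_measure (ennreal (\<bar>c\<bar> ^ n)) (distr (lebn n) (lebn n) T)"
  have "?P = lebn n"
  proof (rule lebn.PiM_eqI)
    fix A :: "nat \<Rightarrow> real set" assume A: "\<And>i. i \<in> {..<n} \<Longrightarrow> A i \<in> sets lborel"
    have B: "(\<lambda>x. c * x + t i) -` A i \<in> sets lborel" if "i \<in> {..<n}" for i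
    proof -
      have "(\<lambda>x. c * x + t i) \<in> borel_measurable borel" by simp
      from measurable_sets[OF this] show ?thesis using A[OF that] by simp
    qed
    have PA: "Pi\<^sub>E {..<n} A \<in> sets (lebn n)" using A by (intro sets_PiM_I_finite) auto
    have "emeasure ?P (Pi\<^sub>E {..<n} A) =
        ennreal (\<bar>c\<bar> ^ n) * emeasure (lebn n) (T -` Pi\<^sub>E {..<n} A \<inter> space (lebn n))"
      using PA by (simp add: emeasure_distr)
    also have "T -` Pi\<^sub>E {..<n} A \<inter> space (lebn n) = Pi\<^sub>E {..<n} (\<lambda>i. (\<lambda>x. c * x + t i) -` A i)"
      unfolding T_def by (auto simp: space_PiM PiE_iff)
    also have "emeasure (lebn n) \<dots> = (\<Prod>i<n. emeasure lborel ((\<lambda>x. c * x + t i) -` A i))"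
      using B by (intro lebn.emeasure_PiM) auto
    also have "ennreal (\<bar>c\<bar> ^ n) * \<dots> =
        (\<Prod>i<n. ennreal \<bar>c\<bar> * emeasure lborel ((\<lambda>x. c * x + t i) -` A i))"
      by (simp add: prod.distrib ennreal_power)
    also have "\<dots> = (\<Prod>i<n. emeasure lborel (A i))"
      by (intro prod.cong refl emeasure_lborel_vimage_affine[symmetric]) (use A c in auto)
    finally show "emeasure ?P (Pi\<^sub>E {..<n} A) = (\<Prod>i<n. emeasure lborel (A i))" .
  qed simp_all
  then have "emeasure (lebn n) A = emeasure ?P A" by simp
  also have "\<dots> = ennreal (\<bar>c\<bar> ^ n) * emeasure (lebn n) (T -` A \<inter> space (lebn n))"
    using A by (simp add: emeasure_distr)
  finally show ?thesis by (simp add: T_def space_lebn)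
qed

text \<open>Written as a preimage under the inverse affine map, a homothet inherits measurability
  and volume directly; images of measurable sets are harder to control.\<close>

lemma homothet_eq_vimage:
  assumes "c \<noteq> 0" "K \<subseteq> rspace n"
  shows "homothet n c K x = (\<lambda>k. \<lambda>i\<in>{..<n}. (1/c) * k i + - x i / c) -` K \<inter> rspace n"
proof (intro set_eqI iffI)
  fix p assume "p \<in> homothet n c K x"
  then obtain k where k: "k \<in> K" "p = (\<lambda>i\<in>{..<n}. c * k i + x i)"
    unfolding homothet_def by auto
  have "(\<lambda>i\<in>{..<n}. (1/c) * p i + - x i / c) = k"
    by (rule rspace_eqI[of _ n]) (use k assms in \<open>auto simp: field_simps\<close>)
  then show "p \<in> (\<lambda>k. \<lambda>i\<in>{..<n}. (1/c) * k i + - x i / c) -` K \<inter> rspace n"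
    using k by simp
next
  fix p assume p: "p \<in> (\<lambda>k. \<lambda>i\<in>{..<n}. (1/c) * k i + - x i / c) -` K \<inter> rspace n"
  let ?k = "\<lambda>i\<in>{..<n}. (1/c) * p i + - x i / c"
  have "p = (\<lambda>i\<in>{..<n}. c * ?k i + x i)"
    by (rule rspace_eqI[of _ n]) (use p assms in \<open>auto simp: field_simps\<close>)
  then show "p \<in> homothet n c K x" unfolding homothet_def using p by blast
qed

lemma sets_homothet:
  assumes "c \<noteq> 0" "K \<in> sets (lebn n)"
  shows "homothet n c K x \<in> sets (lebn n)"
proof -
  have "K \<subseteq> rspace n" using sets.sets_into_space[OF assms(2)] by (simp add: space_lebn)
  then show ?thesis
    using measurable_sets[OF measurable_affine assms(2), of "1/c" "\<lambda>i. - x i / c"] assms(1)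
    by (simp add: homothet_eq_vimage space_lebn)
qed

lemma emeasure_homothet:
  assumes "c \<noteq> 0" "K \<in> sets (lebn n)"
  shows "emeasure (lebn n) (homothet n c K x) = ennreal (\<bar>c\<bar> ^ n) * emeasure (lebn n) K"
proof -
  have K: "K \<subseteq> rspace n" using sets.sets_into_space[OF assms(2)] by (simp add: space_lebn)
  have "emeasure (lebn n) K
      = ennreal (\<bar>1/c\<bar> ^ n) * emeasure (lebn n) (homothet n c K x)"
    unfolding homothet_eq_vimage[OF assms(1) K]
    by (rule emeasure_vimage_affine) (use assms in auto)
  then have "ennreal (\<bar>c\<bar> ^ n) * emeasure (lebn n) K =
      (ennreal (\<bar>c\<bar> ^ n) * ennreal (\<bar>1/c\<bar> ^ n)) * emeasure (lebn n) (homothet n c K x)"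
    by (simp add: mult.assoc)
  also have "ennreal (\<bar>c\<bar> ^ n) * ennreal (\<bar>1/c\<bar> ^ n) = 1"
    using assms(1) by (simp add: power_one_over flip: ennreal_mult power_mult_distrib)
  finally show ?thesis by simp
qed

section \<open>Averaging the overlap with translates\<close>

text \<open>Tonelli for the set of pairs \<open>(x, w)\<close> with \<open>w\<close> in
  \<open>W\<close> and \<open>w - x\<close> in \<open>L\<close>. Its section at \<open>x\<close> is
  the overlap of \<open>W\<close> with \<open>L + x\<close>; its section at a point \<open>w\<close>
  of \<open>W\<close> is \<open>w - L\<close>, a reflected copy with the volume of
  \<open>L\<close>.\<close>

lemma emeasure_correlation:
  assumes [measurable]: "W \<in> sets (lebn n)" "L \<in> sets (lebn n)"
  shows "(\<lambda>x. emeasure (lebn n) (W \<inter> homothet n 1 L x)) \<in> borel_measurable (lebn n)"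
    and "(\<integral>\<^sup>+x. emeasure (lebn n) (W \<inter> homothet n 1 L x) \<partial>lebn n)
      = emeasure (lebn n) W * emeasure (lebn n) L"
proof -
  interpret S: sigma_finite_measure "lebn n" by (rule sigma_finite_lebn)
  interpret P: pair_sigma_finite "lebn n" "lebn n" by standard
  have L: "L \<subseteq> rspace n" using sets.sets_into_space[OF assms(2)] by (simp add: space_lebn)
  have W: "W \<subseteq> rspace n" using sets.sets_into_space[OF assms(1)] by (simp add: space_lebn)
  define D where "D = (\<lambda>(x, w). \<lambda>i\<in>{..<n}. w i - x i :: real)"
  have D [measurable]: "D \<in> measurable (lebn n \<Otimes>\<^sub>M lebn n) (lebn n)"
    unfolding D_def by measurable
  define G where "G = (D -` L \<inter> space (lebn n \<Otimes>\<^sub>M lebn n)) \<inter> (rspace n \<times> W)"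
  have G: "G \<in> sets (lebn n \<Otimes>\<^sub>M lebn n)"
    unfolding G_def space_lebn[symmetric]
    by (intro sets.Int measurable_sets[OF D assms(2)] pair_measureI sets.top assms(1))
  have sec1: "Pair x -` G = W \<inter> homothet n 1 L x" if "x \<in> space (lebn n)" for x
    using that L W unfolding homothet_eq_vimage[OF one_neq_zero L] G_def D_def
    by (auto simp: space_pair_measure space_lebn)
  have sec2: "(\<lambda>x. (x, w)) -` G = (if w \<in> W then homothet n (-1) L w else {})" for w
    using L W unfolding homothet_eq_vimage[of "-1", OF _ L, simplified] G_def D_def
    by (auto simp: space_pair_measure space_lebn)
  show "(\<lambda>x. emeasure (lebn n) (W \<inter> homothet n 1 L x)) \<in> borel_measurable (lebn n)"
    using S.measurable_emeasure_Pair[OF G] by (rule measurable_cong[THEN iffD1, rotated]) (simp add: sec1)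
  have "(\<integral>\<^sup>+x. emeasure (lebn n) (W \<inter> homothet n 1 L x) \<partial>lebn n)
      = (\<integral>\<^sup>+x. emeasure (lebn n) (Pair x -` G) \<partial>lebn n)"
    by (intro nn_integral_cong) (simp add: sec1)
  also have "\<dots> = (\<integral>\<^sup>+w. emeasure (lebn n) ((\<lambda>x. (x, w)) -` G) \<partial>lebn n)"
    using S.emeasure_pair_measure_alt[OF G] P.emeasure_pair_measure_alt2[OF G] by simp
  also have "\<dots> = (\<integral>\<^sup>+w. emeasure (lebn n) L * indicator W w \<partial>lebn n)"
    by (intro nn_integral_cong) (simp add: sec2 emeasure_homothet indicator_def)
  also have "\<dots> = emeasure (lebn n) W * emeasure (lebn n) L"
    unfolding nn_integral_cmult_indicator[OF assms(1)] by (rule mult.commute)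
  finally show "(\<integral>\<^sup>+x. emeasure (lebn n) (W \<inter> homothet n 1 L x) \<partial>lebn n)
      = emeasure (lebn n) W * emeasure (lebn n) L" .
qed

text \<open>\<open>W\<close> meets \<open>L + x\<close> only for \<open>x\<close> in
  \<open>W - L\<close>, hence in \<open>E\<close>. The total overlap |W| |L| is thus spread over a
  set of volume |E|, and some translate receives at least the average. The product form avoids
  dividing by |E|.\<close>

lemma exists_large_intersection:
  assumes W: "W \<in> sets (lebn n)" and L: "L \<in> sets (lebn n)" and E: "E \<in> sets (lebn n)"
    and fin: "emeasure (lebn n) E < \<infinity>" "emeasure (lebn n) W < \<infinity>" "emeasure (lebn n) L < \<infinity>"
    and sub: "\<And>w l. w \<in> W \<Longrightarrow> l \<in> L \<Longrightarrow> (\<lambda>i\<in>{..<n}. w i - l i) \<in> E"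
  obtains x where "x \<in> rspace n"
    "emeasure (lebn n) W * emeasure (lebn n) L
      \<le> emeasure (lebn n) (W \<inter> homothet n 1 L x) * emeasure (lebn n) E"
proof (rule ccontr)
  note obt = that
  assume "\<not> thesis"
  let ?m = "emeasure (lebn n)"
  let ?a = "?m W * ?m L"
  let ?f = "\<lambda>x. ?m (W \<inter> homothet n 1 L x)"
  have lt: "?f x * ?m E < ?a" if "x \<in> rspace n" for x
    using \<open>\<not> thesis\<close> obt[OF that] by (meson not_le_imp_less)
  have zero: "?f x = 0" if "x \<in> rspace n" "x \<notin> E" for x
  proof -
    have "W \<inter> homothet n 1 L x = {}"
    proof (rule ccontr)
      assume "W \<inter> homothet n 1 L x \<noteq> {}"
      then obtain l where l: "l \<in> L" "(\<lambda>i\<in>{..<n}. l i + x i) \<in> W" by (auto simp: homothet_def)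
      from sub[OF l(2,1)] have "(\<lambda>i\<in>{..<n}. (\<lambda>i\<in>{..<n}. l i + x i) i - l i) \<in> E" .
      also have "(\<lambda>i\<in>{..<n}. (\<lambda>i\<in>{..<n}. l i + x i) i - l i) = x"
        by (rule rspace_eqI[of _ n]) (use that in auto)
      finally show False using that by simp
    qed
    then show ?thesis by simp
  qed
  have int: "(\<integral>\<^sup>+x. ?f x * ?m E \<partial>lebn n) = ?a * ?m E"
    using emeasure_correlation[OF W L] by (simp add: nn_integral_multc)
  have a_fin: "?a < \<infinity>" using fin by (simp add: ennreal_mult_less_top)
  \<comment> \<open>The negated claim is a strict inequality with a nonnegative left side, so a
    single point already forces \<open>?a\<close> to be positive.\<close>
  have a_pos: "?a \<noteq> 0"
    using lt[of "\<lambda>i\<in>{..<n}. 0"] by auto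
  have e_pos: "?m E \<noteq> 0"
  proof
    assume "?m E = 0"
    then have "AE x in lebn n. x \<notin> E"
      using E by (intro AE_not_in) (auto simp: null_sets_def)
    with AE_space have "AE x in lebn n. ?f x = 0"
      by eventually_elim (use zero in \<open>auto simp: space_lebn\<close>)
    then have "(\<integral>\<^sup>+x. ?f x \<partial>lebn n) = 0"
      using emeasure_correlation(1)[OF W L] by (simp add: nn_integral_0_iff_AE)
    then show False using emeasure_correlation(2)[OF W L] a_pos by simp
  qed
  \<comment> \<open>Both integrals equal \<open>?a * ?m E\<close>, so strictness is the
    contradiction. It comes from the strict inequality on \<open>E\<close>, a set of positive
    measure.\<close>
  have "(\<integral>\<^sup>+x. ?f x * ?m E \<partial>lebn n) < (\<integral>\<^sup>+x. ?a * indicator E x \<partial>lebn n)"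
  proof (rule nn_integral_less)
    show "(\<lambda>x. ?f x * ?m E) \<in> borel_measurable (lebn n)"
      using emeasure_correlation(1)[OF W L] by simp
    show "(\<lambda>x. ?a * indicator E x) \<in> borel_measurable (lebn n)" using E by simp
    show "(\<integral>\<^sup>+x. ?f x * ?m E \<partial>lebn n) \<noteq> \<infinity>"
      unfolding int using a_fin fin(1) by (simp add: ennreal_mult_eq_top_iff less_top[symmetric])
    have "?f x * ?m E \<le> ?a * indicator E x" if "x \<in> rspace n" for x
      using lt[OF that] zero[OF that] by (cases "x \<in> E") auto
    then show "AE x in lebn n. ?f x * ?m E \<le> ?a * indicator E x"
      by (auto intro!: AE_I2 simp: space_lebn)
    show "\<not> (AE x in lebn n. ?a * indicator E x \<le> ?f x * ?m E)"
    proof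
      assume "AE x in lebn n. ?a * indicator E x \<le> ?f x * ?m E"
      moreover have "AE x in lebn n. x \<in> rspace n" by (rule AE_I2) (simp add: space_lebn)
      ultimately have "AE x in lebn n. x \<notin> E"
      proof eventually_elim
        case (elim x)
        then show ?case using lt[of x] by (auto simp: indicator_def split: if_splits)
      qed
      then have "?m E = 0" using E AE_iff_measurable[OF E, of "\<lambda>x. x \<notin> E"]
        sets.sets_into_space[OF E] by (auto simp: Int_absorb1)
      then show False using e_pos by simp
    qed
  qed
  also have "\<dots> = ?a * ?m E" using E by (simp add: nn_integral_cmult_indicator)
  finally show False using int by simp
qed

section \<open>Compact sets\<close>

lemma topspace_rspace_top [simp]: "topspace (rspace_top n) = rspace n"
  by (simp add: rspace_top_def rspace_def)

lemma Hausdorff_rspace_top: "Hausdorff_space (rspace_top n)"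
  by (simp add: rspace_top_def Hausdorff_space_product_topology)

lemma continuous_map_coordinate:
  assumes "i \<in> I"
  shows "continuous_map (product_topology (\<lambda>_. euclideanreal) I) euclideanreal (\<lambda>x. x i)"
  using continuous_map_product_projection[OF assms, of "\<lambda>_. euclideanreal"] by simp

text \<open>For functions on all of \<open>nat\<close> the product sigma-algebra consists of the
  Borel sets. There the preimage of \<open>K\<close> under restriction is closed, and extension by
  \<open>0\<close> is a measurable map that pulls it back to \<open>K\<close>.\<close>

lemma closedin_rspace_top_sets:
  assumes "closedin (rspace_top n) K"
  shows "K \<in> sets (lebn n)"
proof -
  have K: "K \<subseteq> rspace n" using closedin_subset[OF assms] by simp
  have "continuous_map (product_topology (\<lambda>_::nat. euclideanreal) UNIV) (rspace_top n)
      (\<lambda>x. restrict x {..<n})"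
    unfolding rspace_top_def continuous_map_componentwise
    by (auto simp: continuous_map_coordinate)
  from closedin_continuous_map_preimage[OF this assms]
  have "closed {x :: nat \<Rightarrow> real. restrict x {..<n} \<in> K}"
    by (simp add: euclidean_product_topology)
  then have B: "{x :: nat \<Rightarrow> real. restrict x {..<n} \<in> K} \<in> sets (Pi\<^sub>M UNIV (\<lambda>_. borel))"
    unfolding sets_PiM_equal_borel by (rule borel_closed)
  have m: "(\<lambda>x i. if i < n then x i else 0) \<in> measurable (lebn n) (Pi\<^sub>M (UNIV :: nat set) (\<lambda>_. borel :: real measure))"
  proof (rule measurable_PiM_single')
    fix i :: nat
    show "(\<lambda>x. if i < n then x i else 0) \<in> borel_measurable (lebn n)"
    proof (cases "i < n")
      case True
      then have "(\<lambda>x. x i) \<in> measurable (lebn n) lborel" by (intro measurable_component_singleton) simp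
      then show ?thesis using True by simp
    qed simp
  qed simp
  have "K = (\<lambda>x i. if i < n then x i else 0) -` {x. restrict x {..<n} \<in> K} \<inter> space (lebn n)"
  proof -
    have "restrict (\<lambda>i. if i < n then x i else 0) {..<n} = x" if "x \<in> rspace n" for x :: "nat \<Rightarrow> real"
      by (rule rspace_eqI[of _ n]) (use that in auto)
    then show ?thesis using K by (auto simp: space_lebn)
  qed
  then show ?thesis using measurable_sets[OF m B] by simp
qed

text \<open>The coordinate projections of \<open>K\<close> are compact, so \<open>K\<close> lies in
  a box of finite volume.\<close>

lemma compactin_rspace_top_fmeasurable:
  assumes "compactin (rspace_top n) K"
  shows "K \<in> fmeasurable (lebn n)"
proof -
  have K: "K \<in> sets (lebn n)"
    using assms by (intro closedin_rspace_top_sets compactin_imp_closedin Hausdorff_rspace_top)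
  have "\<exists>b. \<forall>x\<in>K. \<bar>x i\<bar> \<le> b" if "i < n" for i
  proof -
    have "compactin euclideanreal ((\<lambda>x. x i) ` K)"
      using assms unfolding rspace_top_def
      by (rule image_compactin) (use that in \<open>simp add: continuous_map_coordinate\<close>)
    then have "bounded ((\<lambda>x. x i) ` K)" by (simp add: compact_imp_bounded)
    then show ?thesis by (auto simp: bounded_iff)
  qed
  then obtain b where b: "\<bar>x i\<bar> \<le> b i" if "x \<in> K" "i < n" for x i by metis
  have "K \<subseteq> Pi\<^sub>E {..<n} (\<lambda>i. {- b i..b i})"
  proof
    fix x assume x: "x \<in> K"
    have "x \<in> rspace n" using compactin_subset_topspace[OF assms] x by auto
    moreover have "x i \<in> {- b i..b i}" if "i < n" for i
      using b[OF x that] by (simp add: abs_le_iff)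
    ultimately show "x \<in> Pi\<^sub>E {..<n} (\<lambda>i. {- b i..b i})"
      by (simp add: rspace_def PiE_iff)
  qed
  then have "emeasure (lebn n) K \<le> emeasure (lebn n) (Pi\<^sub>E {..<n} (\<lambda>i. {- b i..b i}))"
    by (intro emeasure_mono sets_PiM_I_finite) auto
  also have "\<dots> = (\<Prod>i<n. emeasure lborel {- b i..b i})"
    by (rule lebn.emeasure_PiM) auto
  also have "\<dots> < \<infinity>"
  proof -
    have "(\<Prod>i<n. emeasure lborel {- b i..b i}) \<noteq> top"
      unfolding ennreal_prod_eq_top by (simp add: emeasure_lborel_Icc_eq)
    then show ?thesis by (simp add: less_top)
  qed
  finally show ?thesis using K by (simp add: fmeasurable_def)
qed

lemma compactin_scaled_difference:
  assumes "compactin (rspace_top n) K"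
  shows "compactin (rspace_top n) {(\<lambda>i\<in>{..<n}. x i - c * y i) | x y. x \<in> K \<and> y \<in> K}"
proof -
  let ?f = "\<lambda>(x, y). \<lambda>i\<in>{..<n}. x i - c * y i"
  have c: "compactin (prod_topology (rspace_top n) (rspace_top n)) (K \<times> K)"
    using assms by (simp add: compactin_Times)
  have proj: "continuous_map (prod_topology (rspace_top n) (rspace_top n)) euclideanreal (\<lambda>p. fst p i)"
             "continuous_map (prod_topology (rspace_top n) (rspace_top n)) euclideanreal (\<lambda>p. snd p i)"
    if "i < n" for i
    using continuous_map_compose[OF continuous_map_fst continuous_map_coordinate, of i "{..<n}"]
      continuous_map_compose[OF continuous_map_snd continuous_map_coordinate, of i "{..<n}"] that
    by (simp_all add: rspace_top_def o_def)
  have "continuous_map (prod_topology (rspace_top n) (rspace_top n)) (rspace_top n) ?f"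
  proof (subst (3) rspace_top_def, unfold continuous_map_componentwise, intro conjI ballI)
    show "?f ` topspace (prod_topology (rspace_top n) (rspace_top n)) \<subseteq> extensional {..<n}" by auto
    fix i assume "i \<in> {..<n}"
    then show "continuous_map (prod_topology (rspace_top n) (rspace_top n)) euclideanreal (\<lambda>p. ?f p i)"
      by (simp add: case_prod_beta proj continuous_map_diff continuous_map_real_mult_left)
  qed
  from image_compactin[OF c this]
  have "compactin (rspace_top n) (?f ` (K \<times> K))" .
  also have "?f ` (K \<times> K) = {(\<lambda>i\<in>{..<n}. x i - c * y i) | x y. x \<in> K \<and> y \<in> K}" by auto
  finally show ?thesis .
qed

lemma emeasure_pos_of_interior:
  assumes "rspace_top n interior_of K \<noteq> {}" "K \<in> sets (lebn n)"
  shows "0 < emeasure (lebn n) K"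
proof -
  obtain x where x: "x \<in> rspace_top n interior_of K" using assms by auto
  have "openin (rspace_top n) (rspace_top n interior_of K)" by simp
  then have "\<exists>U. finite {i \<in> {..<n}. U i \<noteq> topspace euclideanreal} \<and>
      (\<forall>i\<in>{..<n}. openin euclideanreal (U i)) \<and> x \<in> Pi\<^sub>E {..<n} U \<and>
      Pi\<^sub>E {..<n} U \<subseteq> rspace_top n interior_of K"
    using x unfolding rspace_top_def openin_product_topology_alt by (rule bspec)
  then obtain U where op: "\<forall>i\<in>{..<n}. openin euclideanreal (U i)" and xU: "x \<in> Pi\<^sub>E {..<n} U"
      and sub: "Pi\<^sub>E {..<n} U \<subseteq> rspace_top n interior_of K"
    by (elim exE conjE)
  have U: "open (U i)" if "i < n" for i using op that by simp
  have "emeasure lborel (U i) \<noteq> 0" if "i < n" for i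
  proof -
    have "x i \<in> U i" using xU that by auto
    with U[OF that] obtain e where e: "e > 0" "ball (x i) e \<subseteq> U i"
      using open_contains_ball by blast
    have "0 < emeasure lborel {x i - e<..<x i + e}" using e(1) by simp
    also have "\<dots> \<le> emeasure lborel (U i)"
      using e(2) U[OF that] by (intro emeasure_mono) (auto simp: ball_eq_greaterThanLessThan)
    finally show ?thesis by simp
  qed
  then have "0 < (\<Prod>i<n. emeasure lborel (U i))"
    by (simp add: prod_zero_iff zero_less_iff_neq_zero)
  also have "\<dots> = emeasure (lebn n) (Pi\<^sub>E {..<n} U)"
    by (rule lebn.emeasure_PiM[symmetric]) (use U in auto)
  also have "\<dots> \<le> emeasure (lebn n) K"
    using sub interior_of_subset[of "rspace_top n" K] assms(2) by (intro emeasure_mono) auto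
  finally show ?thesis .
qed

section \<open>Passage to real-valued volumes\<close>

lemma emeasure_eq_Vol: "A \<in> fmeasurable (lebn n) \<Longrightarrow> emeasure (lebn n) A = ennreal (Vol n A)"
  by (simp add: Vol_def emeasure_eq_measure2 fmeasurableD fmeasurableD2)

lemma Vol_homothet:
  assumes "c \<noteq> 0" "K \<in> fmeasurable (lebn n)"
  shows "homothet n c K x \<in> fmeasurable (lebn n)" "Vol n (homothet n c K x) = \<bar>c\<bar> ^ n * Vol n K"
proof -
  have e: "emeasure (lebn n) (homothet n c K x) = ennreal (\<bar>c\<bar> ^ n * Vol n K)"
    using assms by (simp add: emeasure_homothet emeasure_eq_Vol fmeasurableD flip: ennreal_mult')
  then show "homothet n c K x \<in> fmeasurable (lebn n)"
    using assms by (auto intro!: fmeasurableI sets_homothet)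
  show "Vol n (homothet n c K x) = \<bar>c\<bar> ^ n * Vol n K"
    unfolding Vol_def[of n "homothet n c K x"] measure_def e by (simp add: Vol_def)
qed

lemma exists_large_intersection_Vol:
  assumes "W \<in> fmeasurable (lebn n)" "L \<in> fmeasurable (lebn n)" "E \<in> fmeasurable (lebn n)"
    and "\<And>w l. w \<in> W \<Longrightarrow> l \<in> L \<Longrightarrow> (\<lambda>i\<in>{..<n}. w i - l i) \<in> E"
  obtains x where "x \<in> rspace n"
    "Vol n W * Vol n L \<le> Vol n (W \<inter> homothet n 1 L x) * Vol n E"
proof -
  obtain x where x: "x \<in> rspace n"
    "emeasure (lebn n) W * emeasure (lebn n) L
      \<le> emeasure (lebn n) (W \<inter> homothet n 1 L x) * emeasure (lebn n) E"
    using exists_large_intersection[of W n L E] assms by (auto simp: fmeasurable_def)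
  have "W \<inter> homothet n 1 L x \<in> fmeasurable (lebn n)"
    using assms Vol_homothet(1)[of 1 L n x] by (intro fmeasurable_Int_fmeasurable fmeasurableD) auto
  with x(2) assms have "ennreal (Vol n W * Vol n L) \<le> ennreal (Vol n (W \<inter> homothet n 1 L x) * Vol n E)"
    by (simp add: emeasure_eq_Vol Vol_def ennreal_mult)
  then have "Vol n W * Vol n L \<le> Vol n (W \<inter> homothet n 1 L x) * Vol n E"
    by (subst (asm) ennreal_le_iff) (simp_all add: Vol_def)
  with x(1) show ?thesis by (rule that)
qed

lemma Vol_Diff_le:
  assumes "W \<in> fmeasurable (lebn n)" "A \<in> sets (lebn n)" "r \<le> Vol n (W \<inter> A)"
  shows "Vol n (W - A) \<le> Vol n W - r"
proof -
  have "measure (lebn n) (W - W \<inter> A) = measure (lebn n) W - measure (lebn n) (W \<inter> A)"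
    by (rule measure_Diff) (use assms in \<open>auto simp: fmeasurable_def\<close>)
  also have "W - W \<inter> A = W - A" by auto
  finally show ?thesis using assms(3) by (simp add: Vol_def)
qed

text \<open>The averaging lemma yields translates of a set \<open>L\<close>. For \<open>L\<close> a
  scaled copy of \<open>K\<close> these are the homothets of the covering.\<close>

lemma homothet_1_homothet:
  "homothet n 1 (homothet n c K (\<lambda>i\<in>{..<n}. 0)) x = homothet n c K x"
  unfolding homothet_def image_image by (intro image_cong refl restrict_ext) simp

lemma compactin_homothet:
  assumes "compactin (rspace_top n) K"
  shows "compactin (rspace_top n) (homothet n c K t)"
  unfolding homothet_def
proof (rule image_compactin[OF assms])
  show "continuous_map (rspace_top n) (rspace_top n) (\<lambda>k. \<lambda>i\<in>{..<n}. c * k i + t i)"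
  proof (subst (2) rspace_top_def, unfold continuous_map_componentwise, intro conjI ballI)
    fix i assume i: "i \<in> {..<n}"
    have "continuous_map (rspace_top n) euclideanreal (\<lambda>k. k i)"
      unfolding rspace_top_def by (rule continuous_map_coordinate[OF i])
    then have "continuous_map (rspace_top n) euclideanreal (\<lambda>k. c * k i + t i)"
      by (intro continuous_map_add continuous_map_real_mult_left) simp_all
    then show "continuous_map (rspace_top n) euclideanreal (\<lambda>k. (\<lambda>i\<in>{..<n}. c * k i + t i) i)"
      using i by simp
  qed auto
qed

section \<open>Convex bodies containing the origin\<close>

text \<open>With the origin in \<open>K\<close>, the copies \<open>cK\<close> grow with
  \<open>c\<close>, and \<open>aK + bK\<close> lies in \<open>cK\<close> for nonnegative
  \<open>a\<close>, \<open>b\<close> with \<open>a + b \<le> c\<close>. Positive volume stands in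
  for non-empty interior.\<close>

locale centered_body =
  fixes n :: nat and K :: "(nat \<Rightarrow> real) set"
  assumes K_compact: "compactin (rspace_top n) K"
    and K_convex: "\<And>x y t. x \<in> K \<Longrightarrow> y \<in> K \<Longrightarrow> t \<in> {0..1} \<Longrightarrow> (\<lambda>i\<in>{..<n}. (1 - t) * x i + t * y i) \<in> K"
    and zero_in: "(\<lambda>i\<in>{..<n}. 0) \<in> K"
    and Vol_K_pos: "0 < Vol n K"
begin

lemma K_fm: "K \<in> fmeasurable (lebn n)"
  by (rule compactin_rspace_top_fmeasurable[OF K_compact])

lemma K_sub: "K \<subseteq> rspace n"
  using compactin_subset_topspace[OF K_compact] by simp

text \<open>Convexity puts the combination into \<open>(a + b)K\<close>; a further convex
  combination with the origin raises the factor to \<open>c\<close>. The later inclusions between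
  sums of scaled copies rest on this.\<close>

lemma combination_in:
  assumes "x \<in> K" "y \<in> K" "0 \<le> a" "0 \<le> b" "a + b \<le> c"
  obtains z where "z \<in> K" "\<And>i. i < n \<Longrightarrow> a * x i + b * y i = c * z i"
proof -
  have cv: "(\<lambda>i\<in>{..<n}. (1 - t) * u i + t * v i) \<in> K" if "u \<in> K" "v \<in> K" "0 \<le> t" "t \<le> 1" for u v t
    using K_convex that by auto
  show ?thesis
  proof (cases "a + b = 0")
    case True
    then have "a = 0" "b = 0" using assms by auto
    then show ?thesis using that[OF zero_in] by simp
  next
    case False
    define u where "u = (\<lambda>i\<in>{..<n}. (1 - b / (a + b)) * x i + b / (a + b) * y i)"
    have u: "u \<in> K" unfolding u_def
      by (rule cv) (use assms False in auto)
    have "(a + b) * (1 - b / (a + b)) = a" "(a + b) * (b / (a + b)) = b"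
      using False by (simp_all add: right_diff_distrib)
    then have ui: "(a + b) * u i = a * x i + b * y i" if "i < n" for i
      using that by (simp only: u_def restrict_apply' lessThan_iff distrib_left flip: mult.assoc)
    have "c > 0" using assms False by auto
    have z: "(\<lambda>i\<in>{..<n}. (1 - (a + b) / c) * (\<lambda>i\<in>{..<n}. 0) i + (a + b) / c * u i) \<in> K"
      by (rule cv[OF zero_in u]) (use assms \<open>c > 0\<close> in auto)
    show ?thesis
      by (rule that[OF z]) (use \<open>c > 0\<close> in \<open>simp add: ui[symmetric]\<close>)
  qed
qed

text \<open>\<open>diff \<delta>\<close> is the region \<open>K - \<delta>K\<close> in which volume
  is tracked. It is large enough to contain \<open>p - \<delta>\<mu>K\<close> for \<open>p\<close>
  in \<open>K\<close> and \<open>\<mu> \<le> 1\<close>, and small enough that subtracting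
  \<open>(1 - \<delta>)K\<close> stays inside \<open>K - K\<close>.\<close>

definition diff :: "real \<Rightarrow> (nat \<Rightarrow> real) set" where
  "diff c = {(\<lambda>i\<in>{..<n}. x i - c * y i) | x y. x \<in> K \<and> y \<in> K}"

lemma diff_1: "diff 1 = difference_body n K"
  by (simp add: diff_def difference_body_def)

lemma diff_fm: "diff c \<in> fmeasurable (lebn n)"
  unfolding diff_def by (rule compactin_rspace_top_fmeasurable[OF compactin_scaled_difference[OF K_compact]])

abbreviation D where "D \<equiv> difference_body n K"

lemma D_fm: "D \<in> fmeasurable (lebn n)"
  using diff_fm[of 1] by (simp add: diff_1)

lemma diff_subset:
  assumes "0 \<le> c" "c \<le> 1" shows "diff c \<subseteq> D"
proof
  fix p assume "p \<in> diff c"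
  then obtain x y where xy: "x \<in> K" "y \<in> K" "p = (\<lambda>i\<in>{..<n}. x i - c * y i)"
    unfolding diff_def by auto
  obtain z where z: "z \<in> K" "\<And>i. i < n \<Longrightarrow> c * y i + 0 * y i = 1 * z i"
    using combination_in[OF xy(2) xy(2), of c 0 1] assms by auto
  have "p = (\<lambda>i\<in>{..<n}. x i - z i)" using z(2) unfolding xy(3) by (intro restrict_ext) simp
  then show "p \<in> D" unfolding difference_body_def using xy z by auto
qed

lemma Vol_mono: "A \<subseteq> B \<Longrightarrow> A \<in> sets (lebn n) \<Longrightarrow> B \<in> fmeasurable (lebn n) \<Longrightarrow> Vol n A \<le> Vol n B"
  unfolding Vol_def by (rule measure_mono_fmeasurable)

lemma Vol_K_le_D: "Vol n K \<le> Vol n D"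
proof (rule Vol_mono)
  show "K \<subseteq> D"
  proof
    fix x assume "x \<in> K"
    then have "x = (\<lambda>i\<in>{..<n}. x i - (\<lambda>i\<in>{..<n}. 0) i)"
      using K_sub by (intro rspace_eqI[of _ n]) auto
    then show "x \<in> D" unfolding difference_body_def using \<open>x \<in> K\<close> zero_in by blast
  qed
qed (use K_fm D_fm in auto)

text \<open>
  A crude form of the Rogers--Shephard inequality: for \<open>x \<in> (K - K)/2\<close> the intersection
  \<open>K \<inter> (x + K)\<close> contains a translate of \<open>K/2\<close>. Integrate its volume over \<open>x\<close>.
\<close>

lemma Vol_D_le: "Vol n D \<le> 4 ^ n * Vol n K"
proof -
  let ?H = "homothet n (1/2) D (\<lambda>i\<in>{..<n}. 0)"
  have H: "?H \<in> fmeasurable (lebn n)" "Vol n ?H = (1/2) ^ n * Vol n D"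
    using Vol_homothet[of "1/2" D n] D_fm by auto
  have low: "ennreal ((1/2) ^ n * Vol n K) \<le> emeasure (lebn n) (K \<inter> homothet n 1 K x)"
    if x: "x \<in> ?H" for x
  proof -
    obtain d where d: "d \<in> D" "x = (\<lambda>i\<in>{..<n}. 1/2 * d i + (\<lambda>i\<in>{..<n}. 0) i)"
      using x unfolding homothet_def by (elim imageE)
    then obtain a b where ab: "a \<in> K" "b \<in> K" "d = (\<lambda>i\<in>{..<n}. a i - b i)"
      unfolding difference_body_def by auto
    \<comment> \<open>\<open>?C\<close> is \<open>(K + a)/2\<close>, which lies in \<open>K\<close>;
      since \<open>x = (a - b)/2\<close>, it is also \<open>x + (K + b)/2\<close>, which lies in
      \<open>x + K\<close>.\<close>
    let ?C = "homothet n (1/2) K (\<lambda>i. (1/2) * a i)"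
    have "?C \<subseteq> K \<inter> homothet n 1 K x"
    proof
      fix p assume "p \<in> ?C"
      then obtain k where k: "k \<in> K" "p = (\<lambda>i\<in>{..<n}. (1/2) * k i + (1/2) * a i)"
        unfolding homothet_def by auto
      obtain z where z: "z \<in> K" "\<And>i. i < n \<Longrightarrow> (1/2) * k i + (1/2) * a i = 1 * z i"
        using combination_in[OF k(1) ab(1), of "1/2" "1/2" 1] by auto
      obtain w where w: "w \<in> K" "\<And>i. i < n \<Longrightarrow> (1/2) * k i + (1/2) * b i = 1 * w i"
        using combination_in[OF k(1) ab(2), of "1/2" "1/2" 1] by auto
      have "p = z" by (rule rspace_eqI[of _ n]) (use z k K_sub in auto)
      moreover have "p = (\<lambda>i\<in>{..<n}. 1 * w i + x i)"
        unfolding k(2) d(2) ab(3)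
      proof (rule restrict_ext)
        fix i assume "i \<in> {..<n}"
        then show "1/2 * k i + 1/2 * a i = 1 * w i + (\<lambda>i\<in>{..<n}. 1/2 * (\<lambda>i\<in>{..<n}. a i - b i) i + (\<lambda>i\<in>{..<n}. 0) i) i"
          using w(2)[of i] by (simp add: field_simps)
      qed
      ultimately show "p \<in> K \<inter> homothet n 1 K x"
        using z(1) w(1) unfolding homothet_def by auto
    qed
    moreover have "K \<inter> homothet n 1 K x \<in> sets (lebn n)"
      using K_fm sets_homothet[of 1 K n x] by auto
    ultimately have "emeasure (lebn n) ?C \<le> emeasure (lebn n) (K \<inter> homothet n 1 K x)"
      by (intro emeasure_mono)
    moreover have "emeasure (lebn n) ?C = ennreal ((1/2) ^ n * Vol n K)"
      using Vol_homothet[of "1/2" K n] K_fm by (simp add: emeasure_eq_Vol)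
    ultimately show ?thesis by simp
  qed
  have "ennreal ((1/2) ^ n * Vol n K) * emeasure (lebn n) ?H
      = (\<integral>\<^sup>+x. ennreal ((1/2) ^ n * Vol n K) * indicator ?H x \<partial>lebn n)"
    using H(1) by (subst nn_integral_cmult_indicator) auto
  also have "\<dots> \<le> (\<integral>\<^sup>+x. emeasure (lebn n) (K \<inter> homothet n 1 K x) \<partial>lebn n)"
    by (intro nn_integral_mono) (use low in \<open>auto simp: indicator_def\<close>)
  also have "\<dots> = emeasure (lebn n) K * emeasure (lebn n) K"
    using emeasure_correlation(2)[of K n K] K_fm by auto
  finally have "ennreal (((1/2) ^ n * Vol n K) * ((1/2) ^ n * Vol n D)) \<le> ennreal (Vol n K * Vol n K)"
    using K_fm H by (simp add: emeasure_eq_Vol ennreal_mult Vol_def)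
  then have "((1/2) ^ n * Vol n K) * ((1/2) ^ n * Vol n D) \<le> Vol n K * Vol n K"
    by (subst (asm) ennreal_le_iff) (simp_all add: Vol_def)
  then have "(1/2) ^ n * (1/2) ^ n * Vol n D \<le> Vol n K"
    using Vol_K_pos by (simp add: ac_simps)
  moreover have "(1/2) ^ n * (1/2) ^ n = 1 / (4::real) ^ n"
    by (simp add: power_one_over flip: power_mult_distrib)
  ultimately show ?thesis by (simp add: field_simps)
qed

section \<open>Volume removed by one homothet\<close>

text \<open>Subtracting \<open>cK\<close> from \<open>K - \<delta>K\<close> stays in
  \<open>K - K\<close> because \<open>\<delta>K + cK\<close> lies in \<open>K\<close>. An average
  translate of \<open>cK\<close> therefore removes at least the fraction |cK| / |K - K| of
  \<open>W\<close>.\<close>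

lemma removal_generic:
  assumes W: "W \<in> fmeasurable (lebn n)" "W \<subseteq> diff \<delta>" and c: "0 < c" "c + \<delta> \<le> 1" "0 \<le> \<delta>"
  obtains x where "x \<in> rspace n"
    "Vol n (W - homothet n c K x) \<le> Vol n W * (1 - c ^ n * Vol n K / Vol n D)"
proof -
  let ?L = "homothet n c K (\<lambda>i\<in>{..<n}. 0)"
  have L: "?L \<in> fmeasurable (lebn n)" "Vol n ?L = c ^ n * Vol n K"
    using Vol_homothet[of c K n] K_fm c by auto
  obtain x where x: "x \<in> rspace n"
    "Vol n W * Vol n ?L \<le> Vol n (W \<inter> homothet n 1 ?L x) * Vol n D"
  proof (rule exists_large_intersection_Vol[OF W(1) L(1) D_fm])
    fix w l assume "w \<in> W" "l \<in> ?L"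
    then have "w \<in> diff \<delta>" using W(2) by auto
    then obtain a b where "a \<in> K" "b \<in> K" "w = (\<lambda>i\<in>{..<n}. a i - \<delta> * b i)"
      unfolding diff_def by auto
    moreover obtain k where "k \<in> K" "l = (\<lambda>i\<in>{..<n}. c * k i + (\<lambda>i\<in>{..<n}. 0) i)"
      using \<open>l \<in> ?L\<close> unfolding homothet_def by (elim imageE)
    ultimately have k: "a \<in> K" "b \<in> K" "k \<in> K" "w = (\<lambda>i\<in>{..<n}. a i - \<delta> * b i)"
        "l = (\<lambda>i\<in>{..<n}. c * k i + (\<lambda>i\<in>{..<n}. 0) i)" by auto
    obtain z where z: "z \<in> K" "\<And>i. i < n \<Longrightarrow> \<delta> * b i + c * k i = 1 * z i"
      using combination_in[OF k(2,3), of \<delta> c 1] c by auto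
    have "(\<lambda>i\<in>{..<n}. w i - l i) = (\<lambda>i\<in>{..<n}. a i - z i)"
      unfolding k(4,5) using z(2) by (intro restrict_ext) (simp add: algebra_simps)
    then show "(\<lambda>i\<in>{..<n}. w i - l i) \<in> D" unfolding difference_body_def using k z by auto
  qed
  have D: "0 < Vol n D" using Vol_K_pos Vol_K_le_D by simp
  have "Vol n W * (c ^ n * Vol n K / Vol n D) \<le> Vol n (W \<inter> homothet n c K x)"
    using x(2) unfolding L(2) homothet_1_homothet times_divide_eq_right pos_divide_le_eq[OF D] .
  moreover have "homothet n c K x \<in> sets (lebn n)"
    using K_fm c by (intro sets_homothet) auto
  ultimately have "Vol n (W - homothet n c K x) \<le> Vol n W - Vol n W * (c ^ n * Vol n K / Vol n D)"
    by (intro Vol_Diff_le[OF W(1)])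
  then show ?thesis using that[OF x(1)] by (simp add: algebra_simps)
qed

text \<open>The average is taken over the small set \<open>p - \<mu>K\<close>, which contains the
  difference of \<open>p - \<delta>\<mu>K\<close> and \<open>(1 - \<delta>)\<mu>K\<close>. The
  guaranteed gain then depends neither on |W| nor on |K - K|.\<close>

lemma removal_at_point:
  assumes W: "W \<in> fmeasurable (lebn n)" and Q: "homothet n (- (\<delta> * \<mu>)) K p \<subseteq> W"
    and c: "0 < \<delta>" "\<delta> < 1" "0 < \<mu>"
  obtains x where "x \<in> rspace n"
    "Vol n (W - homothet n ((1 - \<delta>) * \<mu>) K x) \<le> Vol n W - ((1 - \<delta>) * \<delta>) ^ n * \<mu> ^ n * Vol n K"
proof -
  let ?L = "homothet n ((1 - \<delta>) * \<mu>) K (\<lambda>i\<in>{..<n}. 0)"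
  let ?Q = "homothet n (- (\<delta> * \<mu>)) K p"
  let ?E = "homothet n (- \<mu>) K p"
  have L: "?L \<in> fmeasurable (lebn n)" "Vol n ?L = ((1 - \<delta>) * \<mu>) ^ n * Vol n K"
    using Vol_homothet[of "(1 - \<delta>) * \<mu>" K n] K_fm c by (auto simp: abs_mult)
  have Q': "?Q \<in> fmeasurable (lebn n)" "Vol n ?Q = (\<delta> * \<mu>) ^ n * Vol n K"
    using Vol_homothet[of "- (\<delta> * \<mu>)" K n] K_fm c by (auto simp: abs_mult)
  have E: "?E \<in> fmeasurable (lebn n)" "Vol n ?E = \<mu> ^ n * Vol n K"
    using Vol_homothet[of "- \<mu>" K n] K_fm c by auto
  obtain x where x: "x \<in> rspace n"
    "Vol n ?Q * Vol n ?L \<le> Vol n (?Q \<inter> homothet n 1 ?L x) * Vol n ?E"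
  proof (rule exists_large_intersection_Vol[OF Q'(1) L(1) E(1)])
    fix w l assume "w \<in> ?Q" "l \<in> ?L"
    then obtain b k where k: "b \<in> K" "k \<in> K" "w = (\<lambda>i\<in>{..<n}. - (\<delta> * \<mu>) * b i + p i)"
        "l = (\<lambda>i\<in>{..<n}. (1 - \<delta>) * \<mu> * k i + (\<lambda>i\<in>{..<n}. 0) i)"
      unfolding homothet_def by (elim imageE)
    obtain z where z: "z \<in> K" "\<And>i. i < n \<Longrightarrow> (\<delta> * \<mu>) * b i + ((1 - \<delta>) * \<mu>) * k i = \<mu> * z i"
      by (rule combination_in[OF k(1,2), of "\<delta> * \<mu>" "(1 - \<delta>) * \<mu>" \<mu>]) (use c in \<open>auto simp: left_diff_distrib\<close>)
    have "(\<lambda>i\<in>{..<n}. w i - l i) = (\<lambda>i\<in>{..<n}. - \<mu> * z i + p i)"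
      unfolding k(3,4) using z(2) by (intro restrict_ext) (simp add: algebra_simps)
    then show "(\<lambda>i\<in>{..<n}. w i - l i) \<in> ?E" unfolding homothet_def using z by auto
  qed
  have sL: "homothet n ((1 - \<delta>) * \<mu>) K x \<in> sets (lebn n)"
    using K_fm c by (intro sets_homothet) auto
  have "(((1 - \<delta>) * \<delta>) ^ n * \<mu> ^ n * Vol n K) * (\<mu> ^ n * Vol n K)
      = ((\<delta> * \<mu>) ^ n * Vol n K) * (((1 - \<delta>) * \<mu>) ^ n * Vol n K)"
    by (simp only: power_mult_distrib mult_ac)
  also have "\<dots> \<le> Vol n (?Q \<inter> homothet n ((1 - \<delta>) * \<mu>) K x) * (\<mu> ^ n * Vol n K)"
    using x(2) unfolding L(2) Q'(2) E(2) homothet_1_homothet .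
  finally have "((1 - \<delta>) * \<delta>) ^ n * \<mu> ^ n * Vol n K \<le> Vol n (?Q \<inter> homothet n ((1 - \<delta>) * \<mu>) K x)"
    by (rule mult_right_le_imp_le) (use Vol_K_pos c in simp)
  also have "\<dots> \<le> Vol n (W \<inter> homothet n ((1 - \<delta>) * \<mu>) K x)"
    using Q W Q'(1) sL by (intro Vol_mono fmeasurable_Int_fmeasurable) auto
  finally have "Vol n (W - homothet n ((1 - \<delta>) * \<mu>) K x) \<le> Vol n W - ((1 - \<delta>) * \<delta>) ^ n * \<mu> ^ n * Vol n K"
    by (rule Vol_Diff_le[OF W sL])
  then show ?thesis using that[OF x(1)] by blast
qed

text \<open>A common point would put \<open>p\<close> into
  \<open>y + \<delta>\<mu>K + (1 - \<delta>)\<nu>K\<close>, which lies in \<open>y + \<nu>K\<close>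
  because \<open>\<mu> \<le> \<nu>\<close>. This is why homothets are placed in decreasing
  order.\<close>

lemma uncovered_disjoint:
  assumes p: "p \<in> rspace n" "p \<notin> homothet n \<nu> K y"
    and c: "0 \<le> \<delta>" "\<delta> \<le> 1" "0 \<le> \<mu>" "\<mu> \<le> \<nu>"
  shows "homothet n (- (\<delta> * \<mu>)) K p \<inter> homothet n ((1 - \<delta>) * \<nu>) K y = {}"
proof (rule ccontr)
  assume "\<not> ?thesis"
  then obtain k l where k: "k \<in> K" "l \<in> K"
    "(\<lambda>i\<in>{..<n}. - (\<delta> * \<mu>) * k i + p i) = (\<lambda>i\<in>{..<n}. (1 - \<delta>) * \<nu> * l i + y i)"
    unfolding homothet_def by blast
  have eq: "- (\<delta> * \<mu>) * k i + p i = (1 - \<delta>) * \<nu> * l i + y i" if "i < n" for i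
    using fun_cong[OF k(3), of i] that by simp
  have le: "\<delta> * \<mu> \<le> \<delta> * \<nu>" using c by (simp add: mult_left_mono)
  obtain z where z: "z \<in> K" "\<And>i. i < n \<Longrightarrow> (\<delta> * \<mu>) * k i + ((1 - \<delta>) * \<nu>) * l i = \<nu> * z i"
    by (rule combination_in[OF k(1,2), of "\<delta> * \<mu>" "(1 - \<delta>) * \<nu>" \<nu>]) (use c le in \<open>auto simp: left_diff_distrib mult_left_le_one_le\<close>)
  have "p = (\<lambda>i\<in>{..<n}. \<nu> * z i + y i)"
  proof (rule rspace_eqI[OF p(1)])
    fix i assume "i < n"
    then show "p i = (\<lambda>i\<in>{..<n}. \<nu> * z i + y i) i" using z(2)[of i] eq[of i] by simp
  qed simp
  then show False using p(2) z(1) unfolding homothet_def by blast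
qed

lemma homothet_subset_diff:
  assumes "p \<in> K" "0 \<le> \<delta>" "0 \<le> \<mu>" "\<mu> \<le> 1"
  shows "homothet n (- (\<delta> * \<mu>)) K p \<subseteq> diff \<delta>"
proof
  fix q assume "q \<in> homothet n (- (\<delta> * \<mu>)) K p"
  then obtain k where k: "k \<in> K" "q = (\<lambda>i\<in>{..<n}. - (\<delta> * \<mu>) * k i + p i)"
    unfolding homothet_def by auto
  have "\<delta> * \<mu> \<le> \<delta>" using assms by (simp add: mult_left_le)
  then obtain z where z: "z \<in> K" "\<And>i. i < n \<Longrightarrow> (\<delta> * \<mu>) * k i + 0 * k i = \<delta> * z i"
    using combination_in[OF k(1) k(1), of "\<delta> * \<mu>" 0 \<delta>] assms by auto
  have "q = (\<lambda>i\<in>{..<n}. p i - \<delta> * z i)"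
    unfolding k(2) using z(2) by (intro restrict_ext) simp
  then show "q \<in> diff \<delta>" unfolding diff_def using assms z by auto
qed

end

section \<open>The greedy covering\<close>

context centered_body
begin

text \<open>This is the set \<open>W\<close> after \<open>i\<close> placements. The removed copies
  are the shrunken ones, so that a whole neighbourhood \<open>p - \<delta>\<mu>K\<close> of a point
  missed by the full copies survives.\<close>

definition rest :: "real \<Rightarrow> (nat \<Rightarrow> real) \<Rightarrow> (nat \<Rightarrow> nat \<Rightarrow> real) \<Rightarrow> nat \<Rightarrow> (nat \<Rightarrow> real) set" where
  "rest \<delta> \<mu> y i = diff \<delta> - (\<Union>j<i. homothet n ((1 - \<delta>) * \<mu> j) K (y j))"

lemma rest_Suc:
  "rest \<delta> \<mu> (y(i := x)) (Suc i) = rest \<delta> \<mu> y i - homothet n ((1 - \<delta>) * \<mu> i) K x"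
  unfolding rest_def by (auto simp: lessThan_Suc)

lemma rest_fm:
  assumes "\<delta> < 1" "\<And>j. j < i \<Longrightarrow> 0 < \<mu> j"
  shows "rest \<delta> \<mu> y i \<in> fmeasurable (lebn n)"
proof -
  have "homothet n ((1 - \<delta>) * \<mu> j) K (y j) \<in> sets (lebn n)" if "j < i" for j
    using assms(1) assms(2)[OF that] K_fm by (intro sets_homothet) auto
  then have "(\<Union>j<i. homothet n ((1 - \<delta>) * \<mu> j) K (y j)) \<in> sets (lebn n)"
    by (intro sets.finite_UN) auto
  then show ?thesis unfolding rest_def using diff_fm by (rule fmeasurable_Diff[rotated])
qed

lemma Vol_D_pos: "0 < Vol n D"
  using Vol_K_pos Vol_K_le_D by simp

text \<open>Iterates \<open>removal_generic\<close>. The bound \<open>1 - t \<le> exp (- t)\<close>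
  turns the product of the remaining fractions into the exponential of a sum.\<close>

lemma generic_phase:
  assumes \<delta>: "0 < \<delta>" "\<delta> < 1" and \<mu>: "\<And>j. j < N \<Longrightarrow> 0 < \<mu> j \<and> \<mu> j < 1" and "i \<le> N"
  shows "\<exists>y. (\<forall>j. y j \<in> rspace n) \<and> Vol n (rest \<delta> \<mu> y i)
    \<le> Vol n D * exp (- ((1 - \<delta>) ^ n * Vol n K / Vol n D) * (\<Sum>j<i. \<mu> j ^ n))"
  using \<open>i \<le> N\<close>
proof (induction i)
  case 0
  have "Vol n (diff \<delta>) \<le> Vol n D"
    using diff_subset[of \<delta>] \<delta> diff_fm D_fm by (intro Vol_mono) auto
  then show ?case
    using subsetD[OF K_sub zero_in]
    by (intro exI[of _ "\<lambda>_. \<lambda>i\<in>{..<n}. 0"]) (simp add: rest_def del: restrict_apply)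
next
  case (Suc i)
  let ?a = "(1 - \<delta>) ^ n * Vol n K / Vol n D"
  let ?s = "\<Sum>j<i. \<mu> j ^ n"
  obtain y where y: "\<And>j. y j \<in> rspace n" "Vol n (rest \<delta> \<mu> y i) \<le> Vol n D * exp (- ?a * ?s)"
    using Suc by auto
  have \<mu>i: "0 < \<mu> i" "\<mu> i < 1" using \<mu>[of i] Suc.prems by auto
  have fm: "rest \<delta> \<mu> y i \<in> fmeasurable (lebn n)"
    using \<delta> \<mu> Suc.prems by (intro rest_fm) auto
  have "(1 - \<delta>) * \<mu> i \<le> 1 - \<delta>" using \<delta> \<mu>i by (intro mult_left_le) auto
  then have "(1 - \<delta>) * \<mu> i + \<delta> \<le> 1" by (simp only: le_diff_eq)
  moreover have "0 < (1 - \<delta>) * \<mu> i" using \<delta> \<mu>i by simp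
  ultimately have c: "0 < (1 - \<delta>) * \<mu> i" "(1 - \<delta>) * \<mu> i + \<delta> \<le> 1" by auto
  obtain x where x: "x \<in> rspace n" "Vol n (rest \<delta> \<mu> y i - homothet n ((1 - \<delta>) * \<mu> i) K x)
      \<le> Vol n (rest \<delta> \<mu> y i) * (1 - ((1 - \<delta>) * \<mu> i) ^ n * Vol n K / Vol n D)"
    by (rule removal_generic[OF fm _ c]) (use \<delta> in \<open>auto simp: rest_def\<close>)
  have "1 - ((1 - \<delta>) * \<mu> i) ^ n * Vol n K / Vol n D \<le> exp (- ?a * \<mu> i ^ n)"
    using exp_ge_add_one_self[of "- ?a * \<mu> i ^ n"] by (simp add: power_mult_distrib mult_ac)
  then have "Vol n (rest \<delta> \<mu> y i) * (1 - ((1 - \<delta>) * \<mu> i) ^ n * Vol n K / Vol n D)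
      \<le> Vol n (rest \<delta> \<mu> y i) * exp (- ?a * \<mu> i ^ n)"
    by (rule mult_left_mono) (simp add: Vol_def)
  note order_trans[OF x(2) this]
  also have "\<dots> \<le> Vol n D * exp (- ?a * ?s) * exp (- ?a * \<mu> i ^ n)"
    using y(2) by (rule mult_right_mono) simp
  also have "\<dots> = Vol n D * exp (- ?a * (\<Sum>j<Suc i. \<mu> j ^ n))"
    by (simp add: distrib_left mult.assoc flip: exp_add)
  finally have "Vol n (rest \<delta> \<mu> (y(i := x)) (Suc i))
      \<le> Vol n D * exp (- ?a * (\<Sum>j<Suc i. \<mu> j ^ n))"
    unfolding rest_Suc .
  moreover have "\<forall>j. (y(i := x)) j \<in> rspace n" using x y by simp
  ultimately show ?case by blast
qed

text \<open>\<open>U\<close> is a volume budget: each step either finds \<open>K\<close> already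
  covered by the full copies or spends
  \<open>((1 - \<delta>) * \<delta>) ^ n * \<mu> i ^ n * Vol n K\<close> of it. The copies before
  \<open>m\<close> are those placed by \<open>z\<close>.\<close>

lemma pointed_phase:
  fixes \<mu> :: "nat \<Rightarrow> real" and N :: nat
  assumes \<delta>: "0 < \<delta>" "\<delta> < 1" and \<mu>: "\<And>j. j < N \<Longrightarrow> 0 < \<mu> j \<and> \<mu> j < 1"
    and dec: "\<And>i j. i \<le> j \<Longrightarrow> j < N \<Longrightarrow> \<mu> j \<le> \<mu> i"
    and start: "\<And>j. z j \<in> rspace n" "Vol n (rest \<delta> \<mu> z m) \<le> U"
    and "m \<le> i" "i \<le> N"
  shows "\<exists>y. (\<forall>j. y j \<in> rspace n) \<and> (K \<subseteq> (\<Union>j<i. homothet n (\<mu> j) K (y j)) \<or>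
    Vol n (rest \<delta> \<mu> y i) + ((1 - \<delta>) * \<delta>) ^ n * (\<Sum>j=m..<i. \<mu> j ^ n) * Vol n K \<le> U)"
  using \<open>m \<le> i\<close> \<open>i \<le> N\<close>
proof (induction i rule: dec_induct)
  case base
  then show ?case using start by (intro exI[of _ z]) auto
next
  case (step i)
  let ?q = "((1 - \<delta>) * \<delta>) ^ n"
  obtain y where y: "\<And>j. y j \<in> rspace n" and alt: "K \<subseteq> (\<Union>j<i. homothet n (\<mu> j) K (y j)) \<or>
      Vol n (rest \<delta> \<mu> y i) + ?q * (\<Sum>j=m..<i. \<mu> j ^ n) * Vol n K \<le> U"
    using step by auto
  have \<mu>i: "0 < \<mu> i" "\<mu> i < 1" using \<mu>[of i] step by auto
  show ?case
  proof (cases "K \<subseteq> (\<Union>j<i. homothet n (\<mu> j) K (y j))")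
    case True
    then have "K \<subseteq> (\<Union>j<Suc i. homothet n (\<mu> j) K (y j))" unfolding lessThan_Suc by blast
    then show ?thesis using y by blast
  next
    case False
    \<comment> \<open>A point missed by every full copy so far shows where volume is still
      concentrated: \<open>p - \<delta>\<mu>K\<close> lies entirely in the uncovered region.\<close>
    then obtain p where p: "p \<in> K" "\<And>j. j < i \<Longrightarrow> p \<notin> homothet n (\<mu> j) K (y j)" by auto
    have fm: "rest \<delta> \<mu> y i \<in> fmeasurable (lebn n)"
      using \<delta> \<mu> step by (intro rest_fm) auto
    have "homothet n (- (\<delta> * \<mu> i)) K p \<inter> homothet n ((1 - \<delta>) * \<mu> j) K (y j) = {}" if "j < i" for j
      using p(1) K_sub p(2)[OF that] \<delta> \<mu>i dec[of j i] that step
      by (intro uncovered_disjoint) auto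
    moreover have "homothet n (- (\<delta> * \<mu> i)) K p \<subseteq> diff \<delta>"
      using p(1) \<delta> \<mu>i by (intro homothet_subset_diff) auto
    ultimately have Q: "homothet n (- (\<delta> * \<mu> i)) K p \<subseteq> rest \<delta> \<mu> y i"
      unfolding rest_def by blast
    obtain x where x: "x \<in> rspace n" "Vol n (rest \<delta> \<mu> y i - homothet n ((1 - \<delta>) * \<mu> i) K x)
        \<le> Vol n (rest \<delta> \<mu> y i) - ?q * \<mu> i ^ n * Vol n K"
      by (rule removal_at_point[OF fm Q \<delta> \<mu>i(1)])
    have "Vol n (rest \<delta> \<mu> (y(i := x)) (Suc i))
        + ?q * (\<Sum>j=m..<Suc i. \<mu> j ^ n) * Vol n K \<le> U"
      using x(2) alt False step(1) by (simp add: rest_Suc algebra_simps)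
    moreover have "\<forall>j. (y(i := x)) j \<in> rspace n" using x y by simp
    ultimately show ?thesis by blast
  qed
qed

text \<open>The first \<open>m\<close> homothets are placed generically, the others at missed
  points. By \<open>num\<close>, the exponential factor of the first phase brings a volume of at
  most \<open>4 ^ n * Vol n K\<close> down to
  \<open>((1 - \<delta>) * \<delta>) ^ n * Vol n K\<close>, a budget that the second phase
  overspends once its ratio powers sum to more than \<open>1\<close>.\<close>

lemma cover_decreasing:
  fixes \<mu> :: "nat \<Rightarrow> real" and N :: nat
  assumes \<delta>: "0 < \<delta>" "\<delta> < 1" and \<mu>: "\<And>j. j < N \<Longrightarrow> 0 < \<mu> j \<and> \<mu> j < 1"
    and dec: "\<And>i j. i \<le> j \<Longrightarrow> j < N \<Longrightarrow> \<mu> j \<le> \<mu> i"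
    and num: "4 ^ n \<le> ((1 - \<delta>) * \<delta>) ^ n * exp ((1 - \<delta>) ^ n * (A - 2))" and "2 \<le> A"
    and big: "A * (Vol n D / Vol n K) \<le> C" "C < (\<Sum>j<N. \<mu> j ^ n)"
  shows "\<exists>y. (\<forall>j :: nat. y j \<in> rspace n) \<and> K \<subseteq> (\<Union>j<N. homothet n (\<mu> j) K (y j))"
proof -
  let ?S = "\<lambda>i. \<Sum>j<i. \<mu> j ^ n"
  let ?R = "Vol n D / Vol n K"
  have R: "1 \<le> ?R" using Vol_K_le_D Vol_K_pos by simp
  have "2 * 1 \<le> A * ?R" using R \<open>2 \<le> A\<close> by (intro mult_mono) auto
  then have "2 \<le> C" using big(1) by simp
  \<comment> \<open>\<open>l\<close> is the first index whose partial sum exceeds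
    \<open>C - 1\<close>, and \<open>m = l - 1\<close> separates the phases. One term is at most
    \<open>1\<close>, so the sum before \<open>m\<close> lies between \<open>C - 2\<close> and
    \<open>C - 1\<close>: enough for the first phase, with more than \<open>1\<close> left for the
    second.\<close>
  define l where "l = (LEAST i. C - 1 < ?S i)"
  have l: "C - 1 < ?S l" unfolding l_def by (rule LeastI[of _ N]) (use big(2) in simp)
  have lN: "l \<le> N" unfolding l_def by (rule Least_le) (use big(2) in simp)
  have "l \<noteq> 0" using l \<open>2 \<le> C\<close> by (intro notI) simp
  then obtain m where m: "l = Suc m" using not0_implies_Suc by blast
  have Sm: "?S m \<le> C - 1" using not_less_Least[of m "\<lambda>i. C - 1 < ?S i"] m l_def by fastforce
  have "\<mu> m ^ n \<le> 1" using \<mu>[of m] lN m by (intro power_le_one) auto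
  then have Sm2: "C - 2 \<le> ?S m" using l m by simp
  have mN: "m \<le> N" using lN m by simp
  let ?a = "(1 - \<delta>) ^ n * Vol n K / Vol n D"
  \<comment> \<open>Since \<open>?R\<close> is at least \<open>1\<close>,
    \<open>C - 2 \<ge> A * ?R - 2 \<ge> (A - 2) * ?R\<close>.\<close>
  have "(A - 2) * ?R \<le> C - 2"
    using big(1) R unfolding left_diff_distrib by linarith
  then have "(A - 2) * ?R \<le> ?S m" using Sm2 by simp
  then have "A - 2 \<le> ?S m / ?R" using R by (subst pos_le_divide_eq) auto
  then have "(1 - \<delta>) ^ n * (A - 2) \<le> (1 - \<delta>) ^ n * (?S m / ?R)"
    using \<delta> by (intro mult_left_mono) auto
  also have "\<dots> = ?a * ?S m" by simp
  finally have ex: "(1 - \<delta>) ^ n * (A - 2) \<le> ?a * ?S m" .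
  have q0: "0 < ((1 - \<delta>) * \<delta>) ^ n" using \<delta> by simp
  obtain z where z: "\<And>j. z j \<in> rspace n" "Vol n (rest \<delta> \<mu> z m) \<le> Vol n D * exp (- ?a * ?S m)"
    using generic_phase[where \<delta> = \<delta> and N = N and \<mu> = \<mu> and i = m, OF \<delta> \<mu> mN] by blast
  note z(2)
  also have "Vol n D * exp (- ?a * ?S m) \<le> (4 ^ n * Vol n K) * exp (- ((1 - \<delta>) ^ n * (A - 2)))"
    using ex Vol_D_le Vol_K_pos by (intro mult_mono) auto
  also have "\<dots> \<le> ((1 - \<delta>) * \<delta>) ^ n * exp ((1 - \<delta>) ^ n * (A - 2)) * Vol n K * exp (- ((1 - \<delta>) ^ n * (A - 2)))"
    using num Vol_K_pos by (intro mult_right_mono) auto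
  also have "\<dots> = ((1 - \<delta>) * \<delta>) ^ n * Vol n K"
    by (simp add: exp_minus)
  finally have z': "Vol n (rest \<delta> \<mu> z m) \<le> ((1 - \<delta>) * \<delta>) ^ n * Vol n K" .
  obtain y where y: "\<And>j. y j \<in> rspace n" and alt: "K \<subseteq> (\<Union>j<N. homothet n (\<mu> j) K (y j)) \<or>
    Vol n (rest \<delta> \<mu> y N) + ((1 - \<delta>) * \<delta>) ^ n * (\<Sum>j=m..<N. \<mu> j ^ n) * Vol n K
      \<le> ((1 - \<delta>) * \<delta>) ^ n * Vol n K"
    using pointed_phase[where \<delta> = \<delta> and N = N and \<mu> = \<mu> and z = z and m = m and i = N, OF \<delta> \<mu> dec z(1) z' mN order_refl] by blast
  have "?S N = ?S m + (\<Sum>j=m..<N. \<mu> j ^ n)"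
    using mN by (simp add: lessThan_atLeast0 sum.atLeastLessThan_concat)
  \<comment> \<open>The second phase would have to spend more than its whole budget, leaving a
    negative volume; only the covering alternative remains.\<close>
  then have "1 < (\<Sum>j=m..<N. \<mu> j ^ n)" using Sm big(2) by simp
  then have "((1 - \<delta>) * \<delta>) ^ n * Vol n K * 1 < ((1 - \<delta>) * \<delta>) ^ n * Vol n K * (\<Sum>j=m..<N. \<mu> j ^ n)"
    using q0 Vol_K_pos by (intro mult_strict_left_mono) auto
  moreover have "0 \<le> Vol n (rest \<delta> \<mu> y N)" by (simp add: Vol_def)
  ultimately have "K \<subseteq> (\<Union>j<N. homothet n (\<mu> j) K (y j))" using alt by (auto simp: mult_ac)
  then show ?thesis using y by blast
qed

end

section \<open>The numerical inequality for large dimension\<close>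

text \<open>Take \<open>\<delta> = 1 / (n ln n)\<close>, so that Bernoulli gives
  \<open>(1 - \<delta>) ^ n \<ge> 1 - 1 / ln n\<close>. After taking logarithms and dividing by
  \<open>n\<close>, the terms \<open>ln n\<close> and \<open>ln (ln n)\<close> of
  \<open>A n / n\<close> cancel those of \<open>ln \<delta>\<close>.\<close>

lemma eventually_numeric:
  defines "A \<equiv> \<lambda>n :: nat. real n * ln (real n) + real n * ln (ln (real n)) + 5 * real n"
  shows "eventually (\<lambda>n. 0 < n \<and> 2 \<le> A n \<and> (\<exists>\<delta>. 0 < \<delta> \<and> \<delta> < 1 \<and>
    4 ^ n \<le> ((1 - \<delta>) * \<delta>) ^ n * exp ((1 - \<delta>) ^ n * (A n - 2)))) sequentially"
proof -
  \<comment> \<open>The limit is \<open>5 - 1\<close>: the constant in \<open>A\<close>, less the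
    limit of \<open>(ln n + ln (ln n)) / ln n\<close> lost through the Bernoulli factor. It exceeds
    \<open>ln 4\<close>, the cost of the crude bound on the volume of \<open>K - K\<close>.\<close>
  have "(\<lambda>n. ln (1 - 1 / (real n * ln (real n))) - ln (real n) - ln (ln (real n))
      + (1 - 1 / ln (real n)) * (ln (real n) + ln (ln (real n)) + 5 - 2 / real n)) \<longlonglongrightarrow> 4"
    by real_asymp
  moreover have "ln (4::real) < 4" using ln_le_minus_one[of "4::real"] by simp
  ultimately have "eventually (\<lambda>n. ln 4 < ln (1 - 1 / (real n * ln (real n))) - ln (real n) - ln (ln (real n))
      + (1 - 1 / ln (real n)) * (ln (real n) + ln (ln (real n)) + 5 - 2 / real n)) sequentially"
    by (rule order_tendstoD(1))
  moreover have "eventually (\<lambda>n. 1 < ln (real n)) sequentially" by real_asymp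
  moreover have "eventually (\<lambda>n. 1 < real n) sequentially" by real_asymp
  moreover have "eventually (\<lambda>n. 2 \<le> A n) sequentially" unfolding A_def by real_asymp
  ultimately show ?thesis
  proof eventually_elim
    case (elim n)
    let ?\<delta> = "1 / (real n * ln (real n))"
    have "1 * 1 < real n * ln (real n)" using elim by (intro mult_strict_mono) auto
    then have \<delta>: "0 < ?\<delta>" "?\<delta> < 1" by auto
    have "1 + real n * (- ?\<delta>) \<le> (1 + (- ?\<delta>)) ^ n"
      using \<delta> by (intro Bernoulli_inequality) auto
    then have bern: "1 - 1 / ln (real n) \<le> (1 - ?\<delta>) ^ n" using elim by simp
    have "real n * ln 4 \<le> real n * (ln (1 - ?\<delta>) - ln (real n) - ln (ln (real n))
      + (1 - 1 / ln (real n)) * (ln (real n) + ln (ln (real n)) + 5 - 2 / real n))"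
      using elim by (intro mult_left_mono) auto
    also have "\<dots> = real n * (ln (1 - ?\<delta>) - ln (real n) - ln (ln (real n))) + (1 - 1 / ln (real n)) *
        (real n * (ln (real n) + ln (ln (real n)) + 5 - 2 / real n))"
      by (simp only: distrib_left mult.left_commute)
    also have "real n * (ln (real n) + ln (ln (real n)) + 5 - 2 / real n) = A n - 2"
      using elim unfolding A_def by (simp add: algebra_simps)
    also have "ln (1 - ?\<delta>) - ln (real n) - ln (ln (real n)) = ln ((1 - ?\<delta>) * ?\<delta>)"
    proof -
      have "ln ((1 - ?\<delta>) * ?\<delta>) = ln (1 - ?\<delta>) + ln ?\<delta>" using \<delta> by (intro ln_mult_pos) auto
      also have "ln ?\<delta> = - ln (real n * ln (real n))" using elim \<delta> by (subst ln_div) auto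
      also have "ln (real n * ln (real n)) = ln (real n) + ln (ln (real n))"
        using elim by (intro ln_mult_pos) auto
      finally show ?thesis by simp
    qed
    also have "(1 - 1 / ln (real n)) * (A n - 2) \<le> (1 - ?\<delta>) ^ n * (A n - 2)"
      using bern elim by (intro mult_right_mono) auto
    finally have main: "real n * ln 4 \<le> real n * ln ((1 - ?\<delta>) * ?\<delta>) + (1 - ?\<delta>) ^ n * (A n - 2)"
      by simp
    have "(4::real) ^ n = exp (real n * ln 4)" by (simp add: exp_of_nat_mult)
    also have "\<dots> \<le> exp (real n * ln ((1 - ?\<delta>) * ?\<delta>) + (1 - ?\<delta>) ^ n * (A n - 2))"
      using main by simp
    also have "\<dots> = exp (ln ((1 - ?\<delta>) * ?\<delta>)) ^ n * exp ((1 - ?\<delta>) ^ n * (A n - 2))"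
      by (simp only: exp_add exp_of_nat_mult)
    also have "exp (ln ((1 - ?\<delta>) * ?\<delta>)) = (1 - ?\<delta>) * ?\<delta>"
      using \<delta> by (intro exp_ln mult_pos_pos) auto
    finally show ?case using elim \<delta> by (intro conjI exI[of _ ?\<delta>]) auto
  qed
qed

section \<open>The covering threshold\<close>

lemma convex_body_Vol_pos:
  assumes "convex_body n K"
  shows "K \<in> fmeasurable (lebn n)" "0 < Vol n K"
proof -
  show fm: "K \<in> fmeasurable (lebn n)"
    using assms by (simp add: convex_body_def compactin_rspace_top_fmeasurable)
  then show "0 < Vol n K"
    using emeasure_pos_of_interior[of n K] assms
    by (simp add: emeasure_eq_Vol convex_body_def fmeasurableD)
qed

section \<open>Reduction to bodies containing the origin\<close>

lemma centered_body_translate: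
  assumes K: "convex_body n K" and k0: "k0 \<in> K"
  shows "centered_body n (homothet n 1 K (\<lambda>i. - k0 i))"
proof
  let ?T = "homothet n 1 K (\<lambda>i. - k0 i)"
  show "compactin (rspace_top n) ?T"
    using K by (simp add: convex_body_def compactin_homothet)
  have "(\<lambda>i\<in>{..<n}. 1 * k0 i + - k0 i) \<in> ?T" unfolding homothet_def using k0 by blast
  then show "(\<lambda>i\<in>{..<n}. 0) \<in> ?T" by simp
  show "0 < Vol n ?T" using convex_body_Vol_pos[OF K] Vol_homothet(2)[of 1 K n] by simp
  fix x y and t :: real assume "x \<in> ?T" "y \<in> ?T" and t: "t \<in> {0..1}"
  then obtain a b where ab: "a \<in> K" "x = (\<lambda>i\<in>{..<n}. 1 * a i + - k0 i)"
      "b \<in> K" "y = (\<lambda>i\<in>{..<n}. 1 * b i + - k0 i)"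
    unfolding homothet_def by (elim imageE)
  let ?c = "\<lambda>i\<in>{..<n}. (1 - t) * a i + t * b i"
  have "?c \<in> K" using K ab t by (simp add: convex_body_def)
  moreover have "(\<lambda>i\<in>{..<n}. (1 - t) * x i + t * y i) = (\<lambda>i\<in>{..<n}. 1 * ?c i + - k0 i)"
    unfolding ab by (intro restrict_ext) (simp add: algebra_simps)
  ultimately show "(\<lambda>i\<in>{..<n}. (1 - t) * x i + t * y i) \<in> ?T"
    unfolding homothet_def by blast
qed

lemma difference_body_translate:
  "difference_body n (homothet n 1 K t) = difference_body n K"
proof -
  have eq: "(\<lambda>i\<in>{..<n}. (\<lambda>i\<in>{..<n}. 1 * a i + t i) i - (\<lambda>i\<in>{..<n}. 1 * b i + t i) i)
      = (\<lambda>i\<in>{..<n}. a i - b i)" for a b :: "nat \<Rightarrow> real"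
    by (intro restrict_ext) simp
  show ?thesis
  proof (intro set_eqI iffI)
    fix p assume "p \<in> difference_body n (homothet n 1 K t)"
    then obtain x y where xy: "x \<in> homothet n 1 K t" "y \<in> homothet n 1 K t"
        and p: "p = (\<lambda>i\<in>{..<n}. x i - y i)"
      unfolding difference_body_def by auto
    obtain a where a: "a \<in> K" "x = (\<lambda>i\<in>{..<n}. 1 * a i + t i)"
      using xy(1) unfolding homothet_def by (elim imageE)
    obtain b where b: "b \<in> K" "y = (\<lambda>i\<in>{..<n}. 1 * b i + t i)"
      using xy(2) unfolding homothet_def by (elim imageE)
    show "p \<in> difference_body n K"
      unfolding difference_body_def p a(2) b(2) eq using a(1) b(1) by blast
  next
    fix p assume "p \<in> difference_body n K"
    then obtain a b where ab: "a \<in> K" "b \<in> K" "p = (\<lambda>i\<in>{..<n}. a i - b i)"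
      unfolding difference_body_def by auto
    show "p \<in> difference_body n (homothet n 1 K t)"
      unfolding difference_body_def homothet_def ab(3) eq[of a b, symmetric] using ab(1,2) by blast
  qed
qed

text \<open>Covering \<open>K - k0\<close> by copies \<open>\<lambda>(K - k0) + y\<close> amounts to
  covering \<open>K\<close> by copies \<open>\<lambda>K + (y + k0 - \<lambda>k0)\<close>. The map
  \<open>e\<close> enumerates the indices in use.\<close>

lemma covered_of_translate:
  assumes K: "K \<subseteq> rspace n" and J: "bij_betw e {..<N} J"
    and cov: "homothet n 1 K (\<lambda>i. - k0 i)
      \<subseteq> (\<Union>j<N. homothet n (lam (e j)) (homothet n 1 K (\<lambda>i. - k0 i)) (y j))"
  shows "covered_by_homothets n K lam"
proof -
  \<comment> \<open>For \<open>j\<close> outside \<open>J\<close> the value of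
    \<open>inv_into\<close> is unspecified. This is harmless, since further homothets only enlarge
    the union.\<close>
  define x where "x j = (\<lambda>i\<in>{..<n}. y (inv_into {..<N} e j) i + k0 i - lam j * k0 i)" for j
  have "p \<in> (\<Union>j. homothet n (lam j) K (x j))" if p: "p \<in> K" for p
  proof -
    have "(\<lambda>i\<in>{..<n}. 1 * p i + - k0 i) \<in> homothet n 1 K (\<lambda>i. - k0 i)"
      unfolding homothet_def using p by blast
    then obtain j where j: "j < N" and "(\<lambda>i\<in>{..<n}. 1 * p i + - k0 i)
        \<in> homothet n (lam (e j)) (homothet n 1 K (\<lambda>i. - k0 i)) (y j)"
      using cov by blast
    then obtain k where k: "k \<in> K" and eq: "(\<lambda>i\<in>{..<n}. 1 * p i + - k0 i)
        = (\<lambda>i\<in>{..<n}. lam (e j) * (\<lambda>i\<in>{..<n}. 1 * k i + - k0 i) i + y j i)"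
      unfolding homothet_def by (elim imageE) blast
    have inv: "inv_into {..<N} e (e j) = j"
      using J j by (intro inv_into_f_f) (auto simp: bij_betw_def)
    have "p = (\<lambda>i\<in>{..<n}. lam (e j) * k i + x (e j) i)"
    proof (rule rspace_eqI[of _ n])
      show "p \<in> rspace n" using p K by auto
      fix i assume "i < n"
      then show "p i = (\<lambda>i\<in>{..<n}. lam (e j) * k i + x (e j) i) i"
        using fun_cong[OF eq, of i] by (simp add: x_def inv algebra_simps)
    qed simp
    then show ?thesis using k unfolding homothet_def by blast
  qed
  then show ?thesis
    unfolding covered_by_homothets_def by (intro exI[of _ x]) (auto simp: x_def)
qed

text \<open>Supplies the order required by the second phase, where each earlier ratio must be at
  least the current one.\<close>

lemma decreasing_enumeration:
  fixes lam :: "nat \<Rightarrow> real"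
  assumes "finite J"
  obtains e where "bij_betw e {..<card J} J"
    "\<And>i j. i \<le> j \<Longrightarrow> j < card J \<Longrightarrow> lam (e j) \<le> lam (e i)"
proof -
  let ?js = "sort_key (\<lambda>j. - lam j) (sorted_list_of_set J)"
  have len: "length ?js = card J" using assms by simp
  have "bij_betw ((!) ?js) {..<card J} J"
    using assms by (intro bij_betw_nth) auto
  moreover have "lam (?js ! j) \<le> lam (?js ! i)" if "i \<le> j" "j < card J" for i j
  proof -
    have "map (\<lambda>j. - lam j) ?js ! i \<le> map (\<lambda>j. - lam j) ?js ! j"
      by (rule sorted_nth_mono[OF sorted_sort_key]) (use that len in auto)
    then show ?thesis using that len by simp
  qed
  ultimately show ?thesis by (rule that)
qed

text \<open>A strict lower bound on an infinite sum already holds for a finite partial sum. Finitely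
  many homothets thus suffice, and they can be sorted.\<close>

lemma covered_of_large_sum:
  assumes K: "convex_body n K" and "0 < n"
    and \<delta>: "0 < \<delta>" "\<delta> < 1"
    and num: "4 ^ n \<le> ((1 - \<delta>) * \<delta>) ^ n * exp ((1 - \<delta>) ^ n * (A - 2))" "2 \<le> A"
    and C: "A * (Vol n (difference_body n K) / Vol n K) \<le> C" "0 \<le> C"
    and lam: "\<And>j. 0 \<le> lam j \<and> lam j < 1"
    and big: "ennreal C < (\<Sum>j. ennreal (lam j ^ n))"
  shows "covered_by_homothets n K lam"
proof -
  have Kr: "K \<subseteq> rspace n" using K compactin_subset_topspace by (force simp: convex_body_def)
  obtain k0 where k0: "k0 \<in> K" using convex_body_Vol_pos(2)[OF K] by (force simp: Vol_def)
  let ?T = "homothet n 1 K (\<lambda>i. - k0 i)"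
  interpret centered_body n ?T by (rule centered_body_translate[OF K k0])
  have VT: "Vol n ?T = Vol n K" using Vol_homothet(2)[of 1 K n] convex_body_Vol_pos[OF K] by simp
  obtain M where M: "ennreal C < (\<Sum>j<M. ennreal (lam j ^ n))"
    using big unfolding suminf_eq_SUP less_SUP_iff by blast
  \<comment> \<open>The greedy covering works with positive ratios. As \<open>0 < n\<close>, the
    discarded zeros contribute nothing to the sum.\<close>
  define J where "J = {j \<in> {..<M}. 0 < lam j}"
  have J: "finite J" by (simp add: J_def)
  obtain e where e: "bij_betw e {..<card J} J"
    "\<And>i j. i \<le> j \<Longrightarrow> j < card J \<Longrightarrow> lam (e j) \<le> lam (e i)"
    using decreasing_enumeration[OF J] by blast
  have "C < (\<Sum>j<M. lam j ^ n)"
    using M lam C(2) by (simp add: sum_ennreal ennreal_less_iff)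
  also have "\<dots> = (\<Sum>j\<in>J. lam j ^ n)"
  proof (intro sum.mono_neutral_right ballI)
    fix j assume "j \<in> {..<M} - J"
    then have "lam j = 0" using lam[of j] by (auto simp: J_def)
    then show "lam j ^ n = 0" using \<open>0 < n\<close> by simp
  qed (auto simp: J_def)
  also have "\<dots> = (\<Sum>i<card J. lam (e i) ^ n)"
    by (rule sum.reindex_bij_betw[OF e(1), symmetric])
  finally have sum: "C < (\<Sum>i<card J. lam (e i) ^ n)" .
  have pos: "0 < lam (e j) \<and> lam (e j) < 1" if "j < card J" for j
    using bij_betwE[OF e(1)] that lam by (auto simp: J_def)
  have "\<exists>y. (\<forall>j :: nat. y j \<in> rspace n) \<and> ?T \<subseteq> (\<Union>j<card J. homothet n (lam (e j)) ?T (y j))"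
    by (rule cover_decreasing[OF \<delta> pos e(2) num _ sum])
      (use C(1) in \<open>simp_all add: VT difference_body_translate\<close>)
  then show ?thesis using covered_of_translate[OF Kr e(1)] by blast
qed

section \<open>Existence of the least threshold\<close>

text \<open>Homothets whose ratio powers sum to some \<open>d < 1\<close> have total volume at most
  \<open>d * Vol n K\<close>, too little to cover \<open>K\<close>. The bound keeps the infimum of
  all thresholds away from \<open>0\<close>.\<close>

lemma cover_threshold_ge_1:
  assumes K: "convex_body n K" and "0 < n"
    and c: "\<And>lam :: nat \<Rightarrow> real. (\<And>j. 0 \<le> lam j \<and> lam j < 1) \<Longrightarrow>
      c < (\<Sum>j. ennreal (lam j ^ n)) \<Longrightarrow> covered_by_homothets n K lam"
  shows "1 \<le> c"
proof (rule ccontr)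
  assume "\<not> 1 \<le> c"
  then obtain d' where d': "c < d'" "d' < 1" using dense[of c 1] by (auto simp: not_le)
  then obtain d where d: "d' = ennreal d" "0 \<le> d" by (cases d' rule: ennreal_cases) auto
  have "d < 1" using d d' by (simp add: ennreal_less_one_iff)
  have "0 < ennreal d" using le_less_trans[OF zero_le d'(1)] d by simp
  then have "0 < d" by simp
  \<comment> \<open>The ratio powers form a geometric series with sum exactly \<open>d\<close>. All
    ratios are positive, so the volume formula for homothets applies to each.\<close>
  define lam where "lam j = root n (d * (1/2) ^ Suc j)" for j
  have lam_n: "lam j ^ n = d * (1/2) ^ Suc j" for j
    unfolding lam_def using \<open>0 < n\<close> d(2) by (intro real_root_pow_pos2) auto
  have "(1/2::real) ^ Suc j \<le> 1" for j by (intro power_le_one) auto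
  then have "d * (1/2) ^ Suc j < 1" for j
    using \<open>0 < d\<close> \<open>d < 1\<close> mult_left_le[of "(1/2) ^ Suc j" d] by (intro le_less_trans[of "d * (1/2) ^ Suc j" d 1]) auto
  then have lam: "0 \<le> lam j \<and> lam j < 1" for j
    unfolding lam_def using \<open>0 < n\<close> d(2) by simp
  have "(\<lambda>j. d * (1/2) ^ Suc j) sums (d * 1)"
    by (intro sums_mult power_half_series)
  then have sum: "(\<Sum>j. ennreal (lam j ^ n)) = ennreal d"
    unfolding lam_n using d(2) by (intro sums_unique[symmetric]) (simp add: sums_ennreal)
  have "covered_by_homothets n K lam"
    by (rule c[OF lam]) (use sum d d' in simp)
  then obtain x where x: "K \<subseteq> (\<Union>j. homothet n (lam j) K (x j))"
    unfolding covered_by_homothets_def by blast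
  have fm: "K \<in> fmeasurable (lebn n)" and pos: "0 < Vol n K" using convex_body_Vol_pos[OF K] by auto
  have lp: "0 < lam j" for j unfolding lam_def using \<open>0 < n\<close> \<open>0 < d\<close> by simp
  have hs: "homothet n (lam j) K (x j) \<in> sets (lebn n)" for j
    using fm lp[of j] by (intro sets_homothet) auto
  have he: "emeasure (lebn n) (homothet n (lam j) K (x j)) = ennreal (lam j ^ n) * emeasure (lebn n) K" for j
    using emeasure_homothet[of "lam j" K n "x j"] fm lp[of j] by (simp add: fmeasurableD)
  have "emeasure (lebn n) K \<le> emeasure (lebn n) (\<Union>j. homothet n (lam j) K (x j))"
    by (rule emeasure_mono[OF x]) (use hs in auto)
  also have "\<dots> \<le> (\<Sum>j. emeasure (lebn n) (homothet n (lam j) K (x j)))"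
    by (rule emeasure_subadditive_countably) (use hs in auto)
  also have "\<dots> = (\<Sum>j. ennreal (lam j ^ n)) * emeasure (lebn n) K"
    by (simp add: he)
  also have "\<dots> = ennreal (d * Vol n K)"
    using fm d(2) pos by (simp add: sum emeasure_eq_Vol ennreal_mult)
  finally have "Vol n K \<le> d * Vol n K"
    using fm d(2) pos by (simp add: emeasure_eq_Vol)
  then show False using \<open>d < 1\<close> pos by simp
qed

text \<open>
  On \<^typ>\<open>ennreal\<close>, which is not well-ordered, \<open>LEAST\<close> is junk unless a minimum exists. Strictness
  of the hypothesis on the sum makes the infimum of all thresholds a threshold.
\<close>

lemma f_cover_le:
  assumes K: "convex_body n K" and "0 < n" and "0 < C"
    and C: "\<And>lam :: nat \<Rightarrow> real. (\<And>j. 0 \<le> lam j \<and> lam j < 1) \<Longrightarrow>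
      C < (\<Sum>j. ennreal (lam j ^ n)) \<Longrightarrow> covered_by_homothets n K lam"
  shows "f_cover n K \<le> C"
proof -
  define P where "P c \<longleftrightarrow> 0 < c \<and> (\<forall>lam :: nat \<Rightarrow> real. (\<forall>j. 0 \<le> lam j \<and> lam j < 1) \<longrightarrow>
    c < (\<Sum>j. ennreal (lam j ^ n)) \<longrightarrow> covered_by_homothets n K lam)" for c :: ennreal
  \<comment> \<open>The condition \<open>0 < c\<close> need not pass to an infimum by itself; a
    uniform positive lower bound makes it do so.\<close>
  have "1 \<le> c" if "P c" for c
    by (rule cover_threshold_ge_1[OF K \<open>0 < n\<close>]) (use that in \<open>unfold P_def, blast\<close>)
  then have "1 \<le> Inf (Collect P)" by (intro Inf_greatest) auto
  then have "0 < Inf (Collect P)" by (rule less_le_trans[OF zero_less_one])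
  moreover have "covered_by_homothets n K lam"
    if "\<forall>j. 0 \<le> lam j \<and> lam j < 1" "Inf (Collect P) < (\<Sum>j. ennreal (lam j ^ n))" for lam :: "nat \<Rightarrow> real"
  proof -
    obtain c where "P c" "c < (\<Sum>j. ennreal (lam j ^ n))"
      using \<open>Inf (Collect P) < _\<close> unfolding Inf_less_iff by blast
    then show ?thesis using that(1) unfolding P_def by blast
  qed
  ultimately have "P (Inf (Collect P))"
    unfolding P_def[of "Inf (Collect P)"] by blast
  then have "(LEAST c. P c) = Inf (Collect P)"
    by (rule Least_equality) (simp add: Inf_lower)
  also have "\<dots> \<le> C" using C \<open>0 < C\<close> by (intro Inf_lower CollectI) (unfold P_def, blast)
  finally show ?thesis unfolding f_cover_def P_def .
qed

theorem corollary3: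
  "\<exists>n\<^sub>0 :: nat. \<forall>n \<ge> n\<^sub>0. \<forall>K :: (nat \<Rightarrow> real) set. convex_body n K \<longrightarrow>
     f_cover n K \<le> ennreal (real_of_int
       \<lceil>(real n * ln (real n) + real n * ln (ln (real n)) + 5 * real n)
          * (Vol n (difference_body n K) / Vol n K)\<rceil>)"
proof -
  let ?A = "\<lambda>n. real n * ln (real n) + real n * ln (ln (real n)) + 5 * real n"
  obtain n\<^sub>0 where n\<^sub>0: "\<And>n. n \<ge> n\<^sub>0 \<Longrightarrow> 0 < n \<and> 2 \<le> ?A n \<and> (\<exists>\<delta>. 0 < \<delta> \<and> \<delta> < 1 \<and>
      4 ^ n \<le> ((1 - \<delta>) * \<delta>) ^ n * exp ((1 - \<delta>) ^ n * (?A n - 2)))"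
    using eventually_numeric unfolding eventually_sequentially by blast
  show ?thesis
  proof (intro exI[of _ n\<^sub>0] allI impI)
    fix n K assume n: "n \<ge> n\<^sub>0" and K: "convex_body n K"
    let ?r = "?A n * (Vol n (difference_body n K) / Vol n K)"
    obtain \<delta> where \<delta>: "0 < \<delta>" "\<delta> < 1"
        "4 ^ n \<le> ((1 - \<delta>) * \<delta>) ^ n * exp ((1 - \<delta>) ^ n * (?A n - 2))"
      and A: "2 \<le> ?A n" and n_pos: "0 < n"
      using n\<^sub>0[OF n] by blast
    obtain k0 where k0: "k0 \<in> K" using convex_body_Vol_pos(2)[OF K] by (force simp: Vol_def)
    \<comment> \<open>The translate supplies positivity of the volume of \<open>K - K\<close>, which
      translation does not change.\<close>
    interpret centered_body n "homothet n 1 K (\<lambda>i. - k0 i)" by (rule centered_body_translate[OF K k0])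
    have "0 < Vol n (difference_body n K) / Vol n K"
      using Vol_D_pos convex_body_Vol_pos(2)[OF K] by (simp add: difference_body_translate)
    \<comment> \<open>Positivity is part of being a threshold, and it ensures that
      \<open>ennreal\<close> does not truncate the ceiling to \<open>0\<close>.\<close>
    then have "0 < ?r" using A by (intro mult_pos_pos) auto
    moreover have le: "?r \<le> real_of_int \<lceil>?r\<rceil>" by (rule le_of_int_ceiling)
    ultimately have pos: "0 < real_of_int \<lceil>?r\<rceil>" by (rule less_le_trans)
    show "f_cover n K \<le> ennreal (real_of_int \<lceil>?r\<rceil>)"
    proof (rule f_cover_le[OF K n_pos])
      show "0 < ennreal (real_of_int \<lceil>?r\<rceil>)" using pos by simp
      fix lam :: "nat \<Rightarrow> real"
      assume "\<And>j. 0 \<le> lam j \<and> lam j < 1" "ennreal (real_of_int \<lceil>?r\<rceil>) < (\<Sum>j. ennreal (lam j ^ n))"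
      then show "covered_by_homothets n K lam"
        by (rule covered_of_large_sum[OF K n_pos \<delta> A le less_imp_le[OF pos]])
    qed
  qed
qed

end
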